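(* For $d\ge5$ and $\alpha\in(0,d+1)$, $$\beta\big(\alpha,\Gamma^d\big)\le\alpha-1+\frac{2(d+1-\alpha)}{d+1}.$$
   Context: $\Gamma=\Gamma^d=\{(\xi,|\xi|)\in\mathbb{R}^{d+1}:1\le|\xi|\le 2\}$ is the truncated cone, and $\sigma_\Gamma$ is the pushforward of $d$-dimensional Lebesgue measure on $\{\xi\in\mathbb{R}^d: 1\le|\xi|\le2\}$ under $\xi\mapsto(\xi,|\xi|)$ (comparable to surface measure on $\Gamma$). For a compactly supported (finite, non-negative) Borel measure $\mu$ on $\mathbb{R}^{d+1}$, $\widehat\mu(\xi)=\int e^{-2\pi i\langle\xi,x\rangle}\,d\mu(x)$, $\lVert\mu\rVert$ is the total variation norm, and $$c_\alpha(\mu)=\sup_{x\in\mathbb{R}^{d+1},\,r>0}\frac{\mu(B(x,r))}{r^\alpha}.$$ $\beta(\alpha,\Gamma^d)$ is the supremum over all $\beta\ge0$ for which there is a constant $C$ (allowed to depend on $\beta$, as well as on $\alpha$ and $d$) such that $$\int|\widehat\mu(R\xi)|^2\,d\sigma_\Gamma(\xi)\le C\,\lVert\mu\rVert\, c_\alpha(\mu)\,R^{-\beta}\quad\text{for all }R>0,$$ uniformly over all Borel measures $\mu$ supported in the unit ball of $\mathbb{R}^{d+1}$. *)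

theory Defs
  imports "HOL-Analysis.Analysis"
begin

definition fourier_measure :: "'a::euclidean_space measure \<Rightarrow> 'a \<Rightarrow> complex" where
  "fourier_measure \<mu> \<xi> = (LINT x|\<mu>. exp (- (2 * pi * (\<xi> \<bullet> x)) * \<i>))"

text \<open>The supremum may be infinite, so it is taken in \<^typ>\<open>ennreal\<close>.\<close>

definition c_dim :: "real \<Rightarrow> 'a::euclidean_space measure \<Rightarrow> ennreal" where
  "c_dim \<alpha> \<mu> = (SUP (x, r) \<in> UNIV \<times> {0<..}. emeasure \<mu> (ball x r) / ennreal (r powr \<alpha>))"

definition ball_measures :: "'a::euclidean_space measure set" where
  "ball_measures =
     {\<mu>. sets \<mu> = sets borel \<and> finite_measure \<mu> \<and> emeasure \<mu> (- cball 0 1) = 0}"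

text \<open>
  Euclidean space of dimension $d+1$ is modelled as \<^typ>\<open>'b \<times> real\<close> with \<open>DIM('b) = d\<close>; the product norm
  and inner product are the Euclidean ones.
\<close>

definition cone_measure :: "('b::euclidean_space \<times> real) measure" where
  "cone_measure =
     distr (restrict_space lborel {\<xi>. 1 \<le> norm \<xi> \<and> norm \<xi> \<le> 2}) borel (\<lambda>\<xi>. (\<xi>, norm \<xi>))"

lemma emeasure_cone_measure:
  fixes A :: "('b::euclidean_space \<times> real) set"
  assumes "A \<in> sets borel"
  shows "emeasure cone_measure A =
    emeasure lborel {\<xi>. 1 \<le> norm \<xi> \<and> norm \<xi> \<le> 2 \<and> (\<xi>, norm \<xi>) \<in> A}"
proof -
  let ?S = "{\<xi>::'b. 1 \<le> norm \<xi> \<and> norm \<xi> \<le> 2}"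
  have S: "?S \<in> sets lborel"
    by simp
  have m: "(\<lambda>\<xi>::'b. (\<xi>, norm \<xi>)) \<in> borel_measurable borel"
    by (intro borel_measurable_continuous_onI continuous_intros)
  then have "(\<lambda>\<xi>::'b. (\<xi>, norm \<xi>)) \<in> borel_measurable lborel"
    by simp
  then have m': "(\<lambda>\<xi>::'b. (\<xi>, norm \<xi>)) \<in> borel_measurable (restrict_space lborel ?S)"
    by (rule measurable_restrict_space1)
  have "emeasure cone_measure A =
      emeasure (restrict_space lborel ?S) ((\<lambda>\<xi>. (\<xi>, norm \<xi>)) -` A \<inter> ?S)"
    unfolding cone_measure_def using emeasure_distr[OF m' assms] by (simp add: space_restrict_space)
  also have "\<dots> = emeasure lborel ((\<lambda>\<xi>. (\<xi>, norm \<xi>)) -` A \<inter> ?S)"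
    using S by (intro emeasure_restrict_space) auto
  also have "(\<lambda>\<xi>. (\<xi>, norm \<xi>)) -` A \<inter> ?S = {\<xi>. 1 \<le> norm \<xi> \<and> norm \<xi> \<le> 2 \<and> (\<xi>, norm \<xi>) \<in> A}"
    by auto
  finally show ?thesis .
qed

text \<open>
  The total variation norm of a non-negative measure is its total mass.  The estimate is an
  inequality in \<^typ>\<open>ennreal\<close>: for \<open>C > 0\<close> it holds trivially when \<^term>\<open>c_dim \<alpha> \<mu>\<close> is infinite.
\<close>

definition decay_estimate :: "'a::euclidean_space measure \<Rightarrow> real \<Rightarrow> real \<Rightarrow> real \<Rightarrow> bool" where
  "decay_estimate \<sigma> \<alpha> \<beta> C \<longleftrightarrow>
     (\<forall>\<mu>\<in>ball_measures. \<forall>R>0.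
        (\<integral>\<^sup>+\<xi>. ennreal ((cmod (fourier_measure \<mu> (R *\<^sub>R \<xi>)))\<^sup>2) \<partial>\<sigma>)
          \<le> ennreal C * emeasure \<mu> UNIV * c_dim \<alpha> \<mu> * ennreal (R powr (- \<beta>)))"

text \<open>
  The exponent is parametrized by the measure \<open>\<sigma>\<close> carried by the surface, so that
  \<open>\<beta>(\<alpha>, \<Gamma>)\<close> is \<open>decay_exponent \<alpha> cone_measure\<close>.  The supremum is taken in \<^typ>\<open>ereal\<close>, so a
  finite upper bound asserts in particular that the set of admissible exponents is bounded.
\<close>

definition decay_exponent :: "real \<Rightarrow> 'a::euclidean_space measure \<Rightarrow> ereal" where
  "decay_exponent \<alpha> \<sigma> = (SUP \<beta>\<in>{\<beta>. 0 \<le> \<beta> \<and> (\<exists>C>0. decay_estimate \<sigma> \<alpha> \<beta> C)}. ereal \<beta>)"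

end

theory Submission
  imports Defs "HOL-Number_Theory.Cong"
begin

text \<open>
  Let \<open>n = d + 1\<close> and let \<open>R \<ge> 1\<close> be a frequency scale.  The bound comes from testing the decay
  estimate on a measure \<open>\<mu>\<close> that consists of balls of radius about \<open>1/R\<close> around the points of the
  scaled lattice \<open>s \<int>\<^sup>n\<close> near the origin, with \<open>s = R powr (- \<alpha> / n)\<close>.  For this \<open>s\<close>, which makes
  the normalized mass of a single ball about \<open>R powr (- \<alpha>)\<close>, one has \<open>c\<^sub>\<alpha>(\<mu>) \<le> K \<parallel>\<mu>\<parallel>\<close> with \<open>K\<close>
  independent of \<open>R\<close> (\<open>lattice_measure\<close>).

  The Fourier transform of \<open>\<mu>\<close> resonates with the dual lattice: it is at least \<open>\<parallel>\<mu>\<parallel> / 2\<close> within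
  a fixed distance of every point of \<open>s\<^sup>-\<^sup>1 \<int>\<^sup>n\<close> of size \<open>O(R)\<close>
  (\<open>fourier_large_near_cone_point\<close>).  Rescaled by \<open>1/R\<close>, each dual lattice point on the cone thus
  contributes about \<open>R powr (- d)\<close> to the normalized integral over the truncated cone, and the number
  of contributions is the number of integer points \<open>(w, \<bar>w\<bar>)\<close> on the cone of height about
  \<open>h = s R = R powr (1 - \<alpha> / n)\<close>.  So a decay exponent \<open>\<beta>\<close> bounds this number by a constant times
  \<open>R powr (d - \<beta>) = h powr ((d - \<beta>) / (1 - \<alpha> / n))\<close> (\<open>shell_count_le_of_decay_estimate\<close>).

  On the other hand the number of integer points on the cone of height about \<open>h\<close> is not
  \<open>O(h powr \<gamma>)\<close> for any \<open>\<gamma> < d - 1\<close> (\<open>cone_lattice_points_shell_growth\<close>).  Hence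
  \<open>(d - \<beta>) / (1 - \<alpha> / n) \<ge> d - 1\<close>, which is the asserted inequality.

  The count of integer points is elementary.  In the coordinates \<open>p = (t + x\<^sub>0) / 2\<close>,
  \<open>q = (t - x\<^sub>0) / 2\<close>, \<open>y = x' / 2\<close> the cone reads \<open>p q = \<bar>y\<bar>\<^sup>2\<close> with \<open>y\<close> in \<open>d - 1\<close> variables, so
  every residue vector \<open>y\<close> modulo a prime \<open>p\<close> with \<open>\<bar>y\<bar>\<^sup>2 \<equiv> 0\<close> yields a point of height \<open>O(p)\<close>.
  There are at least \<open>(p - 1) p\<^sup>d\<^sup>-\<^sup>3\<close> such residue vectors (\<open>card_sum_squares_zero_mod_prime\<close>):
  \<open>-1\<close> is a sum of two squares modulo \<open>p\<close>, so the form has an isotropic vector \<open>e\<close>, and on every line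
  \<open>z + t e\<close> with \<open>\<langle>z, e\<rangle> \<noteq> 0\<close> the form is affine and non-constant in \<open>t\<close>, hence has a zero.  Summing
  over \<open>p\<close> needs only that the number of primes up to \<open>Y\<close> is not \<open>O(Y powr \<theta>)\<close> for \<open>\<theta> < 1\<close>
  (\<open>prime_count_not_sublinear\<close>), which Chebyshev's method gives.
\<close>

section \<open>Primes are not too sparse\<close>

text \<open>
  The numbers \<open>1 / (m (n choose m))\<close> form Leibniz' harmonic triangle: each entry \<open>(n, m + 1)\<close> is the
  difference of the entries \<open>(n - 1, m)\<close> and \<open>(n, m)\<close>, and the border consists of the \<open>1 / n\<close>.  So
  every entry in row \<open>n\<close> is an integer combination of \<open>1, 1/2, \<dots>, 1/n\<close>, and the least common
  multiple clears its denominator.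
\<close>
lemma binomial_mult_dvd_Lcm:
  assumes "1 \<le> m" "m \<le> n"
  shows "m * (n choose m) dvd Lcm {1..n::nat}"
  using assms
proof (induction m arbitrary: n rule: nat_induct_at_least[of 1, consumes 1])
  case base
  then show ?case by (auto intro: dvd_Lcm)
next
  case (Suc m)
  then obtain n' where n: "n = Suc n'" by (cases n) auto
  have m: "1 \<le> m" "m \<le> n'" using Suc n by auto
  define L where "L = Lcm {1..n}"
  have "m * (n' choose m) dvd Lcm {1..n'}" using Suc.IH[of n'] m by simp
  also have "\<dots> dvd L" unfolding L_def n by (rule Lcm_subset) auto
  finally obtain a where a: "L = m * (n' choose m) * a" by (elim dvdE)
  have "m * (n choose m) dvd L" using Suc.IH[of n] Suc.prems n unfolding L_def by simp
  then obtain b where b: "L = m * (n choose m) * b" by (elim dvdE)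
  have e1: "real (Suc m) * real (n choose Suc m) = real n * real (n' choose m)"
    unfolding n of_nat_mult[symmetric] using Suc_times_binomial[of m n'] by (simp only:)
  have e2: "real (n - m) * real (n choose m) = real n * real (n' choose m)"
    unfolding n of_nat_mult[symmetric] using binomial_absorb_comp[of "Suc n'" m] by simp
  have "real (Suc m * (n choose Suc m)) * (real a - real b) = real L"
  proof -
    have "real m * (real n * real (n' choose m) * (real a - real b))
        = real n * real L - real m * (real n * real (n' choose m)) * real b"
      unfolding a by (simp add: algebra_simps)
    also have "real m * (real n * real (n' choose m)) * real b = real (n - m) * real L"
      unfolding e2[symmetric] b by (simp add: algebra_simps)
    also have "real n * real L - real (n - m) * real L = real m * real L"
      using m n by (simp add: of_nat_diff algebra_simps)
    also have "real n * real (n' choose m) = real (Suc m * (n choose Suc m))" by (simp only: e1 of_nat_mult)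
    finally show ?thesis using m by simp
  qed
  then have "real_of_int (int (Suc m * (n choose Suc m)) * (int a - int b)) = real_of_int (int L)"
    by (simp only: of_int_mult of_int_diff of_int_of_nat_eq)
  then have "int (Suc m * (n choose Suc m)) * (int a - int b) = int L"
    by (simp only: of_int_eq_iff)
  then have "int (Suc m * (n choose Suc m)) dvd int L" by (metis dvd_triv_left)
  then show ?case unfolding L_def by (simp only: int_dvd_int_iff)
qed

text \<open>
  Each prime \<open>p\<close> enters the least common multiple through a power \<open>p\<^sup>e \<le> n\<close>.
\<close>
lemma Lcm_atLeastAtMost_le:
  "Lcm {1..n::nat} \<le> n ^ card {p. prime p \<and> p \<le> n}"
proof -
  define P where "P = {p. prime p \<and> p \<le> n}"
  define e where "e p = Max {k. p ^ k \<le> n}" for p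
  have fin: "finite {k. p ^ k \<le> n}" if "p \<in> P" for p
  proof (rule finite_subset)
    have "2 \<le> p" using that prime_ge_2_nat by (auto simp: P_def)
    then have "k < p ^ k" for k by (intro power_gt_expt) auto
    then show "{k. p ^ k \<le> n} \<subseteq> {..n}"
      by (auto intro: less_imp_le order.strict_trans2)
  qed simp
  have finP: "finite P" unfolding P_def by (rule finite_subset[of _ "{..n}"]) auto
  have le: "p ^ e p \<le> n" if "p \<in> P" for p
  proof -
    have "n > 0" using that by (cases n) (auto simp: P_def)
    then have "0 \<in> {k. p ^ k \<le> n}" by simp
    then have "e p \<in> {k. p ^ k \<le> n}" unfolding e_def by (intro Max_in[OF fin[OF that]]) blast
    then show ?thesis by simp
  qed
  have "Lcm {1..n} dvd (\<Prod>p\<in>P. p ^ e p)"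
  proof (rule Lcm_least)
    fix m assume m: "m \<in> {1..n}"
    have "m = (\<Prod>p\<in>prime_factors m. p ^ multiplicity p m)"
      using m prime_factorization_nat[of m] by simp
    also have "\<dots> = (\<Prod>p\<in>P. p ^ multiplicity p m)"
    proof (rule prod.mono_neutral_left[OF finP])
      show "prime_factors m \<subseteq> P" using m by (auto simp: P_def in_prime_factors_iff intro: order.trans[OF dvd_imp_le])
      show "\<forall>i\<in>P - prime_factors m. i ^ multiplicity i m = 1"
        using m by (auto simp: P_def in_prime_factors_iff not_dvd_imp_multiplicity_0)
    qed
    also have "\<dots> dvd (\<Prod>p\<in>P. p ^ e p)"
    proof (rule prod_dvd_prod)
      fix p assume p: "p \<in> P"
      have "p ^ multiplicity p m \<le> m" using m by (intro dvd_imp_le multiplicity_dvd) auto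
      then have "multiplicity p m \<le> e p" unfolding e_def using m by (intro Max_ge fin p) auto
      then show "p ^ multiplicity p m dvd p ^ e p" by (rule le_imp_power_dvd)
    qed
    finally show "m dvd (\<Prod>p\<in>P. p ^ e p)" .
  qed
  moreover have "(\<Prod>p\<in>P. p ^ e p) > 0"
    using prime_gt_0_nat by (intro prod_pos) (auto simp: P_def)
  ultimately have "Lcm {1..n} \<le> (\<Prod>p\<in>P. p ^ e p)" by (intro dvd_imp_le)
  also have "\<dots> \<le> (\<Prod>p\<in>P. n)" using le by (intro prod_mono) auto
  finally show ?thesis by (simp add: P_def)
qed

lemma four_power_le_prime_count:
  assumes "n \<ge> 1"
  shows "4 ^ n \<le> real (2 * n) ^ (card {p::nat. prime p \<and> p \<le> 2 * n} + 1)"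
proof -
  let ?c = "card {p::nat. prime p \<and> p \<le> 2 * n}"
  have "(2 * n) choose n \<le> n * ((2 * n) choose n)" using assms by simp
  also have "\<dots> \<le> Lcm {1..2 * n}"
    by (intro dvd_imp_le binomial_mult_dvd_Lcm) (use assms in \<open>auto simp: Lcm_0_iff intro!: Nat.gr0I\<close>)
  also have "\<dots> \<le> (2 * n) ^ ?c" by (rule Lcm_atLeastAtMost_le)
  finally have A: "real ((2 * n) choose n) \<le> real (2 * n) ^ ?c"
    by (metis of_nat_le_iff of_nat_power)
  have "4 ^ n / (2 * real n) \<le> real ((2 * n) choose n)"
    using central_binomial_lower_bound[of n] assms by simp
  with A have "4 ^ n / (2 * real n) \<le> real (2 * n) ^ ?c" by linarith
  then show ?thesis using assms by (simp add: field_simps)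
qed

text \<open>
  Taking logarithms in the previous bound gives at least about \<open>n / ln n\<close> primes up to \<open>2 n\<close>, and
  \<open>ln n\<close> grows more slowly than every positive power of \<open>n\<close>.
\<close>
lemma prime_count_not_sublinear:
  fixes \<theta> C :: real
  assumes \<theta>: "0 \<le> \<theta>" "\<theta> < 1"
  shows "\<exists>n::nat. n \<ge> 1 \<and> C * real (2 * n) powr \<theta> < real (card {p::nat. prime p \<and> p \<le> 2 * n})"
proof (rule ccontr)
  assume "\<not> ?thesis"
  then have bd: "real (card {p::nat. prime p \<and> p \<le> 2 * n}) \<le> C * real (2 * n) powr \<theta>" if "n \<ge> 1" for n::nat
    using that by (auto simp: not_less)
  have lin: "real n * ln 4 \<le> (C * real (2 * n) powr \<theta> + 1) * ln (real (2 * n))" if "n \<ge> 1" for n::nat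
  proof -
    let ?c = "card {p::nat. prime p \<and> p \<le> 2 * n}"
    have "ln (4 ^ n :: real) \<le> ln (real (2 * n) ^ (?c + 1))"
      using four_power_le_prime_count[OF that] that by (subst ln_le_cancel_iff) auto
    then have "real n * ln 4 \<le> real (?c + 1) * ln (real (2 * n))"
      using that by (subst (asm) (1 2) ln_realpow) auto
    also have "\<dots> \<le> (C * real (2 * n) powr \<theta> + 1) * ln (real (2 * n))"
      using bd[OF that] that by (intro mult_right_mono) auto
    finally show ?thesis .
  qed
  define \<epsilon> where "\<epsilon> = (1 - \<theta>) / 2"
  have \<epsilon>: "\<epsilon> > 0" "\<theta> + \<epsilon> < 1" using \<theta> by (auto simp: \<epsilon>_def field_simps)
  have C0: "C \<ge> 0"
  proof -
    have "0 \<le> C * real (2 * 1) powr \<theta>" using bd[of 1] by (meson le_refl of_nat_0_le_iff order_trans)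
    then show ?thesis by (simp add: zero_le_mult_iff)
  qed
  have up: "ln 4 / 2 \<le> (C + 1) / \<epsilon> * x powr (\<theta> + \<epsilon> - 1)" if "n \<ge> 1" "x = real (2 * n)" for n::nat and x
  proof -
    have x: "x \<ge> 2" "x > 0" using that by auto
    have "x / 2 * ln 4 \<le> (C * x powr \<theta> + 1) * ln x" using lin[OF that(1)] that(2) by simp
    also have "\<dots> \<le> ((C + 1) * x powr \<theta>) * (x powr \<epsilon> / \<epsilon>)"
    proof (rule mult_mono)
      show "C * x powr \<theta> + 1 \<le> (C + 1) * x powr \<theta>"
        using x \<theta> ge_one_powr_ge_zero[of x \<theta>] by (simp add: algebra_simps)
      show "ln x \<le> x powr \<epsilon> / \<epsilon>" using x \<epsilon> ln_powr_bound[of x \<epsilon>] by simp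
    qed (use x C0 in auto)
    also have "\<dots> = x * ((C + 1) / \<epsilon> * x powr (\<theta> + \<epsilon> - 1))"
      using x \<epsilon> by (simp add: powr_add powr_diff field_simps)
    finally have "x * (ln 4 / 2) \<le> x * ((C + 1) / \<epsilon> * x powr (\<theta> + \<epsilon> - 1))" by simp
    then show ?thesis using x by (subst (asm) mult_le_cancel_left_pos) auto
  qed
  have f1: "filterlim (\<lambda>n::nat. real (2 * n)) at_top sequentially"
    by (rule filterlim_compose[OF filterlim_real_sequentially]) (auto intro!: filterlim_subseq simp: strict_mono_def)
  have "(\<lambda>n::nat. (C + 1) / \<epsilon> * real (2 * n) powr (\<theta> + \<epsilon> - 1)) \<longlonglongrightarrow> (C + 1) / \<epsilon> * 0"
    by (intro tendsto_mult tendsto_const tendsto_neg_powr f1) (use \<epsilon> in auto)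
  moreover have "\<forall>\<^sub>F n in sequentially. ln 4 / 2 \<le> (C + 1) / \<epsilon> * real (2 * n) powr (\<theta> + \<epsilon> - 1)"
    using eventually_ge_at_top[of 1] by eventually_elim (use up in auto)
  ultimately have "ln 4 / 2 \<le> (C + 1) / \<epsilon> * (0::real)"
    by (intro tendsto_lowerbound) auto
  then show False by simp
qed

section \<open>Zeros of a sum of squares modulo a prime\<close>

lemma dvd_imp_eq_of_atLeastLessThan:
  fixes a b p :: int
  assumes "p dvd a - b" "a \<in> {0..<p}" "b \<in> {0..<p}"
  shows "a = b"
proof -
  have "a mod p = b mod p" using assms(1) by (simp add: mod_eq_dvd_iff)
  then show ?thesis using assms(2,3) by simp
qed

text \<open>
  Pigeonhole: with \<open>p = 2 m + 1\<close>, the \<open>m + 1\<close> residues \<open>x\<^sup>2\<close> and the \<open>m + 1\<close> residues \<open>- 1 - y\<^sup>2\<close>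
  cannot be disjoint.  They cannot both come from multiples of \<open>p\<close>, and the two squares may be
  swapped; so the first one can be taken to be a unit.
\<close>
lemma minus_one_sum_two_squares_mod_prime:
  fixes p :: int
  assumes p: "prime p" and odd: "odd p"
  obtains u v where "p dvd u^2 + v^2 + 1" "\<not> p dvd u"
proof -
  have p2: "p \<ge> 2" using p prime_ge_2_int by blast
  define m where "m = p div 2"
  have pm: "p = 2 * m + 1" using odd by (simp add: m_def)
  have m1: "m \<ge> 1" using p2 pm by auto
  have inj: "inj_on (\<lambda>x. x^2 mod p) {0..m}"
  proof (rule inj_onI)
    fix x y assume xy: "x \<in> {0..m}" "y \<in> {0..m}" "x^2 mod p = y^2 mod p"
    then have "p dvd x^2 - y^2" by (simp add: mod_eq_dvd_iff)
    also have "x^2 - y^2 = (x - y) * (x + y)" by (simp add: power2_eq_square algebra_simps)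
    finally consider "p dvd x - y" | "p dvd x + y" using p prime_dvd_mult_iff by blast
    then show "x = y"
    proof cases
      case 1
      then show ?thesis using xy pm by (intro dvd_imp_eq_of_atLeastLessThan) auto
    next
      case 2
      then have "x + y = 0" using xy pm
        by (intro dvd_imp_eq_of_atLeastLessThan[of p "x + y" 0]) auto
      then show ?thesis using xy by auto
    qed
  qed
  let ?A = "(\<lambda>x. x^2 mod p) ` {0..m}" and ?B = "(\<lambda>x. (- 1 - x) mod p) ` (\<lambda>x. x^2 mod p) ` {0..m}"
  have inj2: "inj_on (\<lambda>x. (- 1 - x) mod p) {0..<p}"
  proof (rule inj_onI)
    fix x y assume xy: "x \<in> {0..<p}" "y \<in> {0..<p}" "(- 1 - x) mod p = (- 1 - y) mod p"
    then have "p dvd y - x" by (simp add: mod_eq_dvd_iff)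
    then show "x = y" using xy dvd_imp_eq_of_atLeastLessThan[of p y x] by auto
  qed
  have sub: "?A \<subseteq> {0..<p}" "?B \<subseteq> {0..<p}" using p2 by auto
  have cA: "card ?A = nat (m + 1)" using inj by (simp add: card_image)
  moreover have "card ?B = card ?A" using sub by (intro card_image inj_on_subset[OF inj2])
  moreover have "card (?A \<union> ?B) \<le> card {0..<p}" using sub by (intro card_mono) auto
  ultimately have "?A \<inter> ?B \<noteq> {}" using card_Un_disjoint[of ?A ?B] pm m1 by auto
  then obtain x y where xy: "x^2 mod p = (- 1 - y^2 mod p) mod p" by auto
  then have "x^2 mod p = (- 1 - y^2) mod p" by (simp add: mod_diff_right_eq)
  then have d: "p dvd x^2 + y^2 + 1" by (simp add: mod_eq_dvd_iff algebra_simps)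
  show ?thesis
  proof (cases "p dvd x")
    case False
    then show ?thesis using that[of x y] d by simp
  next
    case True
    have "\<not> p dvd y"
    proof
      assume "p dvd y"
      with True have "p dvd x^2 + y^2" by (simp add: power2_eq_square)
      with d have "p dvd 1" using dvd_add_right_iff by blast
      then show False using p not_prime_unit by blast
    qed
    then show ?thesis using that[of y x] d by (simp add: algebra_simps)
  qed
qed

text \<open>
  The vector \<open>e = (u, v, 1, 0, \<dots>, 0)\<close> is isotropic modulo \<open>p\<close>.  Every line in direction \<open>e\<close> has exactly
  one representative \<open>z\<close> with third coordinate \<open>0\<close>; these representatives form the set \<open>G\<close>, and \<open>B\<close>
  collects those orthogonal to \<open>e\<close>.  For \<open>z\<close> outside \<open>B\<close> the value of the form at \<open>z + t e\<close> is
  \<open>\<bar>z\<bar>\<^sup>2 + 2 t \<langle>z, e\<rangle>\<close>, where \<open>2 \<langle>z, e\<rangle>\<close> is a unit, so some \<open>t\<close> makes it vanish.  Distinct lines give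
  distinct zeros, hence there are at least \<open>card G - card B\<close> of them.
\<close>
lemma card_sum_squares_zero_mod_prime:
  fixes p :: int and I :: "'i set"
  assumes p: "prime p" and odd: "odd p" and I: "finite I" "card I \<ge> 3"
  shows "(nat p - 1) * nat p ^ (card I - 2)
    \<le> card {y \<in> I \<rightarrow>\<^sub>E {0..<p}. p dvd (\<Sum>i\<in>I. (y i)^2)}" (is "_ \<le> card ?S")
proof -
  have p2: "p \<ge> 2" using p prime_ge_2_int by blast
  obtain u v where uv: "p dvd u^2 + v^2 + 1" "\<not> p dvd u"
    using minus_one_sum_two_squares_mod_prime[OF p odd] by blast
  obtain J where J: "J \<subseteq> I" "card J = 3" using I obtain_subset_with_card_n by metis
  then obtain i1 i2 i3 where "J = {i1, i2, i3}" and dist: "i1 \<noteq> i2" "i1 \<noteq> i3" "i2 \<noteq> i3"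
    by (auto simp: card_3_iff)
  with J have iI: "i1 \<in> I" "i2 \<in> I" "i3 \<in> I" by auto
  define e where "e i = (if i = i1 then u else 0) + (if i = i2 then v else 0) + (if i = i3 then 1 else 0)" for i
  have e1: "e i1 = u" "e i3 = 1" using dist by (auto simp: e_def)
  have ee: "(\<Sum>i\<in>I. (e i)^2) = u^2 + v^2 + 1"
  proof -
    have "(e i)^2 = (if i = i1 then u^2 else 0) + (if i = i2 then v^2 else 0) + (if i = i3 then 1 else 0)" for i
      using dist by (auto simp: e_def)
    then show ?thesis using I iI by (simp add: sum.distrib)
  qed
  have ze: "(\<Sum>i\<in>I. z i * e i) = z i1 * u + z i2 * v + z i3" for z :: "'i \<Rightarrow> int"
  proof -
    have "z i * e i = (if i = i1 then z i1 * u else 0) + (if i = i2 then z i2 * v else 0)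
        + (if i = i3 then z i3 else 0)" for i
      using dist by (auto simp: e_def)
    then show ?thesis using I iI by (simp add: sum.distrib)
  qed
  have quad: "(\<Sum>i\<in>I. (z i + t * e i)^2)
      = (\<Sum>i\<in>I. (z i)^2) + 2 * t * (\<Sum>i\<in>I. z i * e i) + t^2 * (\<Sum>i\<in>I. (e i)^2)" for z :: "'i \<Rightarrow> int" and t
    by (simp add: power2_sum power_mult_distrib sum.distrib sum_distrib_left algebra_simps)
  define G where "G = (\<Pi>\<^sub>E i\<in>I. if i = i3 then {0} else {0..<p})"
  define B where "B = {z \<in> G. p dvd z i1 * u + z i2 * v}"
  have Gz: "z i \<in> {0..<p}" if "z \<in> G" "i \<in> I" for z i
    using PiE_mem[OF that[unfolded G_def]] p2 by (auto split: if_splits)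
  have G3: "z i3 = 0" if "z \<in> G" for z
    using PiE_mem[OF that[unfolded G_def] iI(3)] by simp
  have finG: "finite G" unfolding G_def using I by (intro finite_PiE) auto
  have cardG: "card G = nat p ^ (card I - 1)"
  proof -
    have "card G = (\<Prod>i\<in>I. if i = i3 then 1 else nat p)"
      unfolding G_def using I by (subst card_PiE) (auto intro: prod.cong)
    also have "\<dots> = nat p ^ card (I - {i3})"
      using I iI by (simp add: prod.If_cases Diff_eq)
    finally show ?thesis using I iI by simp
  qed
  \<comment> \<open>As \<open>u\<close> is a unit, orthogonality to \<open>e\<close> determines the first coordinate from the others.\<close>
  have cardB: "card B \<le> nat p ^ (card I - 2)"
  proof -
    let ?H = "(\<Pi>\<^sub>E i\<in>I. if i \<in> {i1, i3} then {0} else {0..<p})"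
    have "card B \<le> card ?H"
    proof (rule card_inj_on_le[where f = "\<lambda>z. z(i1 := 0)"])
      show "inj_on (\<lambda>z. z(i1 := 0)) B"
      proof (rule inj_onI)
        fix z w assume zw: "z \<in> B" "w \<in> B" "z(i1 := 0) = w(i1 := 0)"
        have off: "z i = w i" if "i \<noteq> i1" for i using fun_cong[OF zw(3), of i] that by simp
        have "p dvd (z i1 * u + z i2 * v) - (w i1 * u + w i2 * v)" using zw by (intro dvd_diff) (auto simp: B_def)
        also have "\<dots> = (z i1 - w i1) * u" using off[of i2] dist by (simp add: algebra_simps)
        finally have "p dvd z i1 - w i1" using uv p prime_dvd_mult_iff by blast
        then have "z i1 = w i1"
          using zw Gz[of z i1] Gz[of w i1] iI by (intro dvd_imp_eq_of_atLeastLessThan[of p]) (simp_all add: B_def)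
        then show "z = w" using off by (intro ext) metis
      qed
      show "(\<lambda>z. z(i1 := 0)) ` B \<subseteq> ?H"
      proof (clarify, rule PiE_I)
        fix z i assume z: "z \<in> B" and i: "i \<in> I"
        show "(z(i1 := 0)) i \<in> (if i \<in> {i1, i3} then {0} else {0..<p})"
          using z i Gz[of z i] G3[of z] by (auto simp: B_def)
      next
        fix z i assume "z \<in> B" and i: "i \<notin> I"
        then show "(z(i1 := 0)) i = undefined" using iI by (auto simp: B_def G_def PiE_def extensional_def)
      qed
      show "finite ?H" using I by (intro finite_PiE) auto
    qed
    also have "card ?H = (\<Prod>i\<in>I. if i \<in> {i1, i3} then 1 else nat p)"
      using I by (subst card_PiE) (auto intro: prod.cong)
    also have "\<dots> = nat p ^ card (I - {i1, i3})"
    proof -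
      have "I \<inter> - {i. i \<in> {i1, i3}} = I - {i1, i3}" by auto
      then show ?thesis using I by (simp only: prod.If_cases prod_constant power_one mult_1)
    qed
    also have "card (I - {i1, i3}) = card I - 2"
      using I iI dist by (subst card_Diff_subset) auto
    finally show ?thesis .
  qed
  have ex: "\<exists>t. p dvd (\<Sum>i\<in>I. (z i + t * e i)^2)" if z: "z \<in> G - B" for z
  proof -
    let ?w = "z i1 * u + z i2 * v"
    have w: "(\<Sum>i\<in>I. z i * e i) = ?w" using ze[of z] G3[of z] z by simp
    have "\<not> p dvd 2" using p odd p2 by (metis dvd_refl dvd_trans not_prime_unit order_antisym prime_dvd_mult_iff zdvd_imp_le zero_less_numeral)
    then have "\<not> p dvd 2 * ?w"
      using z unfolding prime_dvd_mult_iff[OF p] by (simp add: B_def)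
    then have "coprime (2 * ?w) p" using p by (simp add: prime_imp_coprime coprime_commute)
    then obtain r where "[2 * ?w * r = 1] (mod p)" using cong_solve_coprime_int by blast
    then have r: "p dvd 2 * ?w * r - 1" by (simp add: cong_iff_dvd_diff)
    \<comment> \<open>The root of the affine function \<open>t \<mapsto> \<bar>z\<bar>\<^sup>2 + 2 t \<langle>z, e\<rangle>\<close>, with \<open>r\<close> the inverse of its slope.\<close>
    let ?t = "- r * (\<Sum>i\<in>I. (z i)^2)"
    have "(\<Sum>i\<in>I. (z i + ?t * e i)^2) = - (2 * ?w * r - 1) * (\<Sum>i\<in>I. (z i)^2) + ?t^2 * (u^2 + v^2 + 1)"
      unfolding quad w ee by (simp add: algebra_simps)
    also have "p dvd \<dots>"
      by (rule dvd_add[OF dvd_mult2[OF dvd_minus_iff[THEN iffD2, OF r]] dvd_mult[OF uv(1)]])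
    finally show ?thesis by blast
  qed
  then obtain t where t: "\<And>z. z \<in> G - B \<Longrightarrow> p dvd (\<Sum>i\<in>I. (z i + t z * e i)^2)" by metis
  define Y where "Y z = (\<lambda>i\<in>I. (z i + t z * e i) mod p)" for z
  have "card (G - B) \<le> card ?S"
  proof (rule card_inj_on_le[where f = Y])
    show "finite ?S" using I by (intro finite_subset[OF _ finite_PiE[of I "\<lambda>_. {0..<p}"]]) auto
    show "Y ` (G - B) \<subseteq> ?S"
    proof (clarify, intro conjI)
      fix z assume z: "z \<in> G" "z \<notin> B"
      show "Y z \<in> I \<rightarrow>\<^sub>E {0..<p}" using p2 by (auto simp: Y_def)
      have "[(\<Sum>i\<in>I. (Y z i)^2) = (\<Sum>i\<in>I. (z i + t z * e i)^2)] (mod p)"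
        by (intro cong_sum cong_pow) (simp add: Y_def cong_def)
      then show "p dvd (\<Sum>i\<in>I. (Y z i)^2)" using t[of z] z by (simp add: cong_dvd_iff)
    qed
    show "inj_on Y (G - B)"
    proof (rule inj_onI)
      fix z w assume z: "z \<in> G - B" and w: "w \<in> G - B" and eq: "Y z = Y w"
      have c: "p dvd (z i + t z * e i) - (w i + t w * e i)" if "i \<in> I" for i
        using fun_cong[OF eq, of i] that by (simp add: Y_def mod_eq_dvd_iff)
      have tt: "p dvd t z - t w" using c[OF iI(3)] G3[of z] G3[of w] z w e1 by simp
      show "z = w"
      proof (rule PiE_ext)
        show "z \<in> PiE I (\<lambda>i. if i = i3 then {0} else {0..<p})" "w \<in> PiE I (\<lambda>i. if i = i3 then {0} else {0..<p})"
          using z w by (auto simp: G_def)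
        fix i assume i: "i \<in> I"
        have "p dvd ((z i + t z * e i) - (w i + t w * e i)) - (t z - t w) * e i"
          by (rule dvd_diff[OF c[OF i] dvd_mult2[OF tt]])
        also have "\<dots> = z i - w i" by (simp add: algebra_simps)
        finally show "z i = w i"
          using z w i Gz[of z i] Gz[of w i] by (intro dvd_imp_eq_of_atLeastLessThan[of p]) simp_all
      qed
    qed
  qed
  moreover have "card (G - B) = card G - card B" using finG by (intro card_Diff_subset) (auto simp: B_def)
  moreover have "nat p ^ (card I - 1) - nat p ^ (card I - 2) = (nat p - 1) * nat p ^ (card I - 2)"
  proof -
    have "card I - 1 = Suc (card I - 2)" using I by simp
    then show ?thesis by (simp add: diff_mult_distrib)
  qed
  ultimately show ?thesis using cardG cardB by linarith
qed

section \<open>The integer lattice\<close>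

definition int_lattice :: "'a::euclidean_space set" where
  "int_lattice = {z. \<forall>b\<in>Basis. z \<bullet> b \<in> \<int>}"

definition lattice_vector :: "('a \<Rightarrow> int) \<Rightarrow> 'a::euclidean_space" where
  "lattice_vector g = (\<Sum>b\<in>Basis. real_of_int (g b) *\<^sub>R b)"

lemma inner_lattice_vector [simp]: "b \<in> Basis \<Longrightarrow> lattice_vector g \<bullet> b = real_of_int (g b)"
  unfolding lattice_vector_def by (rule inner_sum_left_Basis)

lemma lattice_vector_in_int_lattice [simp]: "lattice_vector g \<in> int_lattice"
  by (simp add: int_lattice_def)

lemma inj_on_lattice_vector: "inj_on (lattice_vector :: _ \<Rightarrow> 'a::euclidean_space) (Pi\<^sub>E Basis A)"
proof (rule inj_onI)
  fix g h assume gh: "g \<in> Pi\<^sub>E Basis A" "h \<in> Pi\<^sub>E Basis A"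
    "(lattice_vector g :: 'a) = lattice_vector h"
  show "g = h"
  proof (rule PiE_ext[OF gh(1,2)])
    fix b :: 'a assume b: "b \<in> Basis"
    then show "g b = h b" using gh(3) by (metis inner_lattice_vector of_int_eq_iff)
  qed
qed

lemma int_lattice_box_eq:
  "{z \<in> int_lattice. \<forall>b\<in>Basis. z \<bullet> b \<in> S b}
    = lattice_vector ` (\<Pi>\<^sub>E b\<in>Basis. {i. real_of_int i \<in> S b})" (is "?L = ?R")
proof
  show "?R \<subseteq> ?L" by (auto simp: PiE_iff)
  show "?L \<subseteq> ?R"
  proof
    fix z assume z: "z \<in> ?L"
    define g where "g = (\<lambda>b\<in>Basis. \<lfloor>z \<bullet> b\<rfloor>)"
    have gz: "real_of_int (g b) = z \<bullet> b" if "b \<in> Basis" for b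
      using z that by (auto simp: g_def int_lattice_def elim!: Ints_cases)
    have "g \<in> (\<Pi>\<^sub>E b\<in>Basis. {i. real_of_int i \<in> S b})"
    proof (rule PiE_I)
      fix b :: 'a assume b: "b \<in> Basis"
      then show "g b \<in> {i. real_of_int i \<in> S b}" using z gz[OF b] by simp
    qed (simp add: g_def)
    moreover have "z = lattice_vector g" by (rule euclidean_eqI) (simp add: gz)
    ultimately show "z \<in> ?R" by blast
  qed
qed

lemma card_int_lattice_box:
  "card {z \<in> int_lattice. \<forall>b\<in>Basis. z \<bullet> b \<in> S b} = (\<Prod>b\<in>Basis. card {i. real_of_int i \<in> S b})"
  unfolding int_lattice_box_eq
  by (subst card_image[OF inj_on_lattice_vector]) (simp add: card_PiE)

lemma finite_int_lattice_box:
  assumes "\<And>b. b \<in> Basis \<Longrightarrow> bounded (S b)"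
  shows "finite {z \<in> int_lattice. \<forall>b\<in>Basis. z \<bullet> b \<in> S b}"
proof -
  have "finite {i. real_of_int i \<in> S b}" if b: "b \<in> Basis" for b
  proof -
    obtain K where K: "\<And>x. x \<in> S b \<Longrightarrow> \<bar>x\<bar> \<le> K" using assms[OF b] by (auto simp: bounded_iff)
    have "{i. real_of_int i \<in> S b} \<subseteq> {-\<lceil>K\<rceil>..\<lceil>K\<rceil>}"
    proof
      fix i assume "i \<in> {i. real_of_int i \<in> S b}"
      with K[of "real_of_int i"] show "i \<in> {-\<lceil>K\<rceil>..\<lceil>K\<rceil>}" by (simp, linarith)
    qed
    then show ?thesis by (rule finite_subset) simp
  qed
  then show ?thesis unfolding int_lattice_box_eq by (intro finite_imageI finite_PiE) auto
qed

text \<open>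
  The two box counts are uniform in the scale \<open>L\<close>; the upper one also covers boxes smaller than
  the mesh of the lattice, which occur when balls of radius below the lattice spacing are tested.
\<close>
lemma card_int_lattice_box_le:
  fixes c :: "'a::euclidean_space"
  assumes "L \<ge> 0"
  shows "real (card {z \<in> int_lattice. \<forall>b\<in>Basis. z \<bullet> b \<in> {c \<bullet> b - L..c \<bullet> b + L}}) \<le> (2 * L + 1) ^ DIM('a)"
proof -
  have "real (card {i. real_of_int i \<in> {x - L..x + L}}) \<le> 2 * L + 1" for x
  proof -
    have "{i. real_of_int i \<in> {x - L..x + L}} = {\<lceil>x - L\<rceil>..\<lfloor>x + L\<rfloor>}"
      by (auto simp: ceiling_le_iff le_floor_iff)
    then show ?thesis using assms by (simp add: of_nat_nat) linarith
  qed
  then have "(\<Prod>b\<in>(Basis::'a set). real (card {i. real_of_int i \<in> {c \<bullet> b - L..c \<bullet> b + L}}))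
      \<le> (\<Prod>b\<in>(Basis::'a set). 2 * L + 1)"
    by (intro prod_mono) auto
  then show ?thesis unfolding card_int_lattice_box by simp
qed

lemma card_int_lattice_box_ge:
  assumes "L \<ge> 0"
  shows "L ^ DIM('a::euclidean_space)
    \<le> real (card {z::'a \<in> int_lattice. \<forall>b\<in>Basis. z \<bullet> b \<in> {- L..L}})"
proof -
  have "L \<le> real (card {i. real_of_int i \<in> {- L..L}})"
  proof -
    have "{i. real_of_int i \<in> {- L..L}} = {- \<lfloor>L\<rfloor>..\<lfloor>L\<rfloor>}"
      by (auto simp: le_floor_iff) linarith+
    moreover have L0: "0 \<le> \<lfloor>L\<rfloor>" using assms by simp
    ultimately have "real (card {i. real_of_int i \<in> {- L..L}}) = 2 * real_of_int \<lfloor>L\<rfloor> + 1" by simp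
    then show ?thesis using L0 floor_correct[of L] by linarith
  qed
  then have "(\<Prod>b\<in>(Basis::'a set). L) \<le> (\<Prod>b\<in>(Basis::'a set). real (card {i. real_of_int i \<in> {- L..L}}))"
    using assms by (intro prod_mono) auto
  then show ?thesis unfolding card_int_lattice_box by simp
qed

lemma inner_int_lattice: "w \<in> int_lattice \<Longrightarrow> z \<in> int_lattice \<Longrightarrow> w \<bullet> z \<in> \<int>"
  unfolding int_lattice_def by (subst euclidean_inner) (auto intro!: Ints_sum)

lemma int_lattice_separated:
  assumes "w \<in> int_lattice" "z \<in> int_lattice" "w \<noteq> z"
  shows "1 \<le> norm (w - z)"
proof -
  have "w - z \<in> int_lattice" using assms by (auto simp: int_lattice_def inner_diff_left)
  then have "(w - z) \<bullet> (w - z) \<in> \<int>" by (intro inner_int_lattice)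
  moreover have "(w - z) \<bullet> (w - z) > 0" using assms by simp
  ultimately obtain k :: int where k: "(w - z) \<bullet> (w - z) = real_of_int k" "real_of_int k > 0"
    by (auto elim!: Ints_cases)
  then have "k \<ge> 1" by (simp only: of_int_0_less_iff)
  then have "1 \<le> (w - z) \<bullet> (w - z)" by (simp only: k of_int_1_le_iff)
  then show ?thesis by (simp add: norm_eq_sqrt_inner)
qed

section \<open>Integer points on the cone\<close>

text \<open>
  The integer points \<open>(x, \<bar>x\<bar>)\<close> on the light cone with height in the interval from \<open>lo\<close> to \<open>hi\<close>,
  recorded by their projection \<open>x\<close>.
\<close>
definition cone_lattice_points :: "real \<Rightarrow> real \<Rightarrow> 'b::euclidean_space set" where
  "cone_lattice_points lo hi = {x \<in> int_lattice. norm x \<in> \<int> \<and> lo < norm x \<and> norm x \<le> hi}"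

lemma finite_cone_lattice_points: "finite (cone_lattice_points lo hi)"
proof (rule finite_subset)
  show "cone_lattice_points lo hi \<subseteq> {z \<in> int_lattice. \<forall>b\<in>Basis. z \<bullet> b \<in> {- hi..hi}}"
    using Basis_le_norm by (auto simp: cone_lattice_points_def abs_le_iff intro: order.trans)
       (metis abs_le_iff minus_le_iff order_trans)
qed (rule finite_int_lattice_box, simp)

lemma norm_squared_Basis: "(norm (x::'a::euclidean_space))^2 = (\<Sum>b\<in>Basis. (x \<bullet> b)^2)"
  unfolding power2_norm_eq_inner by (subst euclidean_inner) (simp add: power2_eq_square)

text \<open>
  Single out one coordinate \<open>b0\<close>.  If \<open>p q = \<bar>y\<bar>\<^sup>2\<close>, then \<open>(p - q, 2 y)\<close> has norm \<open>p + q\<close>, because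
  \<open>(p - q)\<^sup>2 + 4 p q = (p + q)\<^sup>2\<close>.  Both \<open>p\<close> and \<open>y\<close> can be read off from this point and its norm, so
  the zeros modulo different primes give different integer points.  To sum over the primes it
  suffices that among \<open>M\<close> distinct positive integers at least \<open>M / 2\<close> are at least \<open>M / 2\<close>.
\<close>
lemma card_cone_lattice_points_ge:
  assumes dim: "DIM('b::euclidean_space) \<ge> 4"
  shows "(real (card {p::nat. prime p \<and> odd p \<and> p \<le> Y}) / 2) ^ (DIM('b) - 1) / 2
    \<le> real (card (cone_lattice_points 0 (real (DIM('b) * Y)) :: 'b set))"
proof -
  define P where "P = {p::nat. prime p \<and> odd p \<and> p \<le> Y}"
  obtain b0 :: 'b where b0: "b0 \<in> Basis" using nonempty_Basis by blast
  define I where "I = (Basis :: 'b set) - {b0}"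
  have finI: "finite I" and cardI: "card I = DIM('b) - 1" using b0 by (auto simp: I_def)
  have finP: "finite P" unfolding P_def by (rule finite_subset[of _ "{..Y}"]) auto
  define S where "S p = {y \<in> I \<rightarrow>\<^sub>E {0..<int p}. int p dvd (\<Sum>i\<in>I. (y i)^2)}" for p
  have finS: "finite (S p)" for p
    unfolding S_def by (rule finite_subset[OF _ finite_PiE[OF finI, of "\<lambda>_. {0..<int p}"]]) auto
  define q where "q p y = (\<Sum>i\<in>I. (y i)^2) div int p" for p :: nat and y :: "'b \<Rightarrow> int"
  define X where "X = (\<lambda>(p, y). lattice_vector (\<lambda>b. if b = b0 then int p - q p y else 2 * y b) :: 'b)"
  have X0: "X (p, y) \<bullet> b0 = real p - real_of_int (q p y)" for p y
    using b0 by (simp add: X_def)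
  have XI: "X (p, y) \<bullet> i = 2 * real_of_int (y i)" if "i \<in> I" for p y i
    using that by (auto simp: X_def I_def)
  have pq: "int p * q p y = (\<Sum>i\<in>I. (y i)^2)" if "y \<in> S p" for p y
    using that by (auto simp: S_def q_def)
  have q0: "0 \<le> q p y" for p y
    unfolding q_def by (cases "p = 0") (auto intro!: pos_imp_zdiv_nonneg_iff[THEN iffD2] sum_nonneg)
  have nX: "norm (X (p, y)) = real p + real_of_int (q p y)" if y: "y \<in> S p" for p y
  proof -
    have "(norm (X (p, y)))^2 = (X (p, y) \<bullet> b0)^2 + (\<Sum>i\<in>I. (X (p, y) \<bullet> i)^2)"
      unfolding norm_squared_Basis I_def using b0 by (subst sum.remove[OF finite_Basis b0]) auto
    also have "(\<Sum>i\<in>I. (X (p, y) \<bullet> i)^2) = 4 * real_of_int (\<Sum>i\<in>I. (y i)^2)"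
      by (simp add: XI sum_distrib_left power_mult_distrib)
    also have "real_of_int (\<Sum>i\<in>I. (y i)^2) = real p * real_of_int (q p y)"
      unfolding pq[OF y, symmetric] by simp
    also have "(X (p, y) \<bullet> b0)^2 + 4 * (real p * real_of_int (q p y)) = (real p + real_of_int (q p y))^2"
      unfolding X0 by (simp add: power2_eq_square algebra_simps)
    finally show ?thesis using q0[of p y] by (subst (asm) power2_eq_iff_nonneg) auto
  qed
  have qle: "q p y \<le> int (DIM('b) - 1) * int p" if y: "y \<in> S p" and p: "p \<in> P" for p y
  proof -
    have p0: "int p > 0" using p prime_gt_0_nat by (auto simp: P_def)
    have "(\<Sum>i\<in>I. (y i)^2) \<le> (\<Sum>i\<in>I. int p ^ 2)"
      using y by (intro sum_mono power_mono) (auto simp: S_def PiE_iff)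
    then have "int p * q p y \<le> int p * (int (DIM('b) - 1) * int p)"
      unfolding pq[OF y] by (simp add: cardI power2_eq_square algebra_simps)
    then show ?thesis using p0 by (subst (asm) mult_le_cancel_left_pos) auto
  qed
  have inj: "inj_on X (Sigma P S)"
  proof (rule inj_onI, clarify)
    fix p y p' y' assume p: "p \<in> P" "p' \<in> P" and y: "y \<in> S p" "y' \<in> S p'" and eq: "X (p, y) = X (p', y')"
    have "2 * real p = norm (X (p, y)) + X (p, y) \<bullet> b0" using nX[OF y(1)] X0[of p y] by simp
    also have "\<dots> = 2 * real p'" unfolding eq using nX[OF y(2)] X0[of p' y'] by simp
    finally have pp: "p = p'" by simp
    have "y = y'"
    proof (rule PiE_ext)
      show "y \<in> I \<rightarrow>\<^sub>E {0..<int p}" "y' \<in> I \<rightarrow>\<^sub>E {0..<int p}" using y pp by (auto simp: S_def)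
      fix i assume "i \<in> I"
      then show "y i = y' i" using XI[of i p y] XI[of i p' y'] eq by simp
    qed
    with pp show "p = p' \<and> y = y'" by simp
  qed
  have img: "X ` Sigma P S \<subseteq> cone_lattice_points 0 (real (DIM('b) * Y))"
  proof clarify
    fix p y assume p: "p \<in> P" and y: "y \<in> S p"
    have p0: "p > 0" "p \<le> Y" using p prime_gt_0_nat by (auto simp: P_def)
    have "real p + real_of_int (q p y) \<le> real p + real_of_int (int (DIM('b) - 1) * int p)"
      using qle[OF y p] by (simp only: of_int_le_iff add_le_cancel_left)
    also have "\<dots> = real (DIM('b) * p)" using DIM_positive[where 'a='b] by (simp add: of_nat_diff algebra_simps)
    also have "\<dots> \<le> real (DIM('b) * Y)" using p0 by (intro of_nat_mono mult_left_mono) auto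
    finally have "norm (X (p, y)) \<le> real (DIM('b) * Y)" using nX[OF y] by simp
    moreover have "0 < norm (X (p, y))" unfolding nX[OF y] using p0 q0[of p y] by simp
    moreover have "norm (X (p, y)) \<in> \<int>" unfolding nX[OF y] by simp
    ultimately show "X (p, y) \<in> cone_lattice_points 0 (real (DIM('b) * Y))"
      by (simp add: cone_lattice_points_def X_def)
  qed
  define M where "M = real (card P)"
  define P' where "P' = {p \<in> P. M / 2 \<le> real p}"
  have k: "DIM('b) - 1 = Suc (DIM('b) - 2)" using dim by auto
  have cS: "(M / 2) ^ (DIM('b) - 2) / 2 \<le> real (card (S p))" if p: "p \<in> P'" for p
  proof -
    have p': "prime (int p)" "odd (int p)" and p2: "p \<ge> 2" and Mp: "M / 2 \<le> real p"
      using p prime_ge_2_nat[of p] by (auto simp: P'_def P_def)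
    have k': "DIM('b) - 2 = Suc (DIM('b) - 3)" using dim by auto
    have "(M / 2) ^ (DIM('b) - 2) / 2 \<le> real p ^ (DIM('b) - 2) / 2"
      using Mp by (intro divide_right_mono power_mono) (auto simp: M_def)
    also have "\<dots> = real p / 2 * real p ^ (DIM('b) - 3)" unfolding k' by simp
    also have "\<dots> \<le> real (p - 1) * real p ^ (DIM('b) - 3)"
      using p2 by (intro mult_right_mono) auto
    also have "\<dots> = real ((nat (int p) - 1) * nat (int p) ^ (card I - 2))"
      unfolding cardI by (simp add: numeral_3_eq_3 numeral_2_eq_2)
    also have "\<dots> \<le> real (card (S p))"
      unfolding S_def using dim cardI finI p'
      by (intro of_nat_mono card_sum_squares_zero_mod_prime) auto
    finally show ?thesis .
  qed
  have finP': "finite P'" "P' \<subseteq> P" using finP by (auto simp: P'_def)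
  have cP': "M / 2 \<le> real (card P')"
  proof -
    have "P - P' \<subseteq> {1..nat \<lfloor>M / 2\<rfloor>}"
    proof
      fix p assume "p \<in> P - P'"
      then have "real p < M / 2" "p > 0" using prime_gt_0_nat by (auto simp: P'_def P_def)
      then show "p \<in> {1..nat \<lfloor>M / 2\<rfloor>}" by (simp, linarith)
    qed
    then have "card (P - P') \<le> card {1..nat \<lfloor>M / 2\<rfloor>}" by (intro card_mono) auto
    then have "real (card (P - P')) \<le> M / 2" by (simp add: M_def) linarith
    moreover have "card P = card P' + card (P - P')"
      using card_Un_disjoint[of P' "P - P'"] finP finP' by (simp add: Un_absorb1 Un_Diff_cancel)
    ultimately show ?thesis unfolding M_def by simp
  qed
  have "(M / 2) ^ (DIM('b) - 1) / 2 = M / 2 * ((M / 2) ^ (DIM('b) - 2) / 2)" unfolding k by simp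
  also have "\<dots> \<le> real (card P') * ((M / 2) ^ (DIM('b) - 2) / 2)"
    using cP' by (intro mult_right_mono) (auto simp: M_def)
  also have "\<dots> = (\<Sum>p\<in>P'. (M / 2) ^ (DIM('b) - 2) / 2)" by simp
  also have "\<dots> \<le> (\<Sum>p\<in>P'. real (card (S p)))" using cS by (rule sum_mono)
  also have "\<dots> \<le> (\<Sum>p\<in>P. real (card (S p)))" using finP finP' by (intro sum_mono2) auto
  also have "\<dots> = real (card (Sigma P S))" using finP finS by (simp add: card_SigmaI)
  also have "card (Sigma P S) = card (X ` Sigma P S)" by (rule card_image[OF inj, symmetric])
  also have "real \<dots> \<le> real (card (cone_lattice_points 0 (real (DIM('b) * Y)) :: 'b set))"
    using img finite_cone_lattice_points by (intro of_nat_mono card_mono)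
  finally show ?thesis unfolding M_def P_def .
qed

text \<open>
  If all shells had \<open>O(h powr \<gamma>)\<close> points, then summing the geometric series of shells with ratio
  \<open>3/2\<close> would bound the number of points of height at most \<open>X\<close> by \<open>O(X powr \<gamma>)\<close>, and the number of
  primes up to \<open>Y\<close> by \<open>O(Y powr (\<gamma> / (d - 1)))\<close>.  After rescaling
  by \<open>1/h\<close> the shells from \<open>5/4 h\<close> to \<open>15/8 h\<close> leave room for small balls around their points
  inside the annulus from \<open>1\<close> to \<open>2\<close>.
\<close>
lemma cone_lattice_points_shell_growth:
  fixes C \<gamma> :: real
  assumes dim: "DIM('b::euclidean_space) \<ge> 4" and \<gamma>: "\<gamma> < real (DIM('b) - 1)"
  shows "\<exists>h\<ge>1. C * h powr \<gamma> < real (card (cone_lattice_points (5/4 * h) (15/8 * h) :: 'b set))"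
proof (rule ccontr)
  assume "\<not> ?thesis"
  then have bd0: "real (card (cone_lattice_points (5/4 * h) (15/8 * h) :: 'b set)) \<le> C * h powr \<gamma>" if "h \<ge> 1" for h
    using that by (auto simp: not_less)
  have C0: "C \<ge> 0" using bd0[of 1] by (simp add: order.trans[OF of_nat_0_le_iff])
  \<comment> \<open>Positivity of the exponent makes the geometric series of shells grow.\<close>
  define g where "g = max \<gamma> (1/2)"
  have g: "g > 0" "g < real (DIM('b) - 1)" using \<gamma> dim by (auto simp: g_def)
  have bd: "real (card (cone_lattice_points (5/4 * h) (15/8 * h) :: 'b set)) \<le> C * h powr g" if "h \<ge> 1" for h
    using bd0[OF that] C0 powr_mono[of \<gamma> g h] that mult_left_mono[of "h powr \<gamma>" "h powr g" C]
    by (auto simp: g_def)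
  define T where "T X = real (card (cone_lattice_points 0 X :: 'b set))" for X
  have Tmono: "T X \<le> T Y" if "X \<le> Y" for X Y
    unfolding T_def using that
    by (intro of_nat_mono card_mono finite_cone_lattice_points) (auto simp: cone_lattice_points_def)
  define r where "r = (3/2 :: real) powr g"
  have r: "r > 1" unfolding r_def using g by (intro gr_one_powr) auto
  \<comment> \<open>The second entry is what the induction step \<open>A r\<^sup>j + C r\<^sup>j \<le> A r\<^sup>j\<^sup>+\<^sup>1\<close> requires.\<close>
  define A where "A = max (T (5/4)) (C / (r - 1))"
  have A: "A \<ge> T (5/4)" "C \<le> A * (r - 1)" "A \<ge> 0"
    using r by (auto simp: A_def pos_divide_le_eq[symmetric] T_def)
  have TH: "T (5/4 * (3/2) ^ j) \<le> A * r ^ j" for j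
  proof (induction j)
    case 0
    then show ?case using A by simp
  next
    case (Suc j)
    let ?h = "(3/2 :: real) ^ j"
    have h: "?h \<ge> 1" by simp
    have hp: "?h powr g = r ^ j" unfolding r_def
      by (simp add: powr_realpow[symmetric] powr_powr mult.commute del: powr_realpow)
    have eq: "5/4 * (3/2) ^ Suc j = 15/8 * ?h" by simp
    have "T (15/8 * ?h) \<le> real (card (cone_lattice_points 0 (5/4 * ?h) \<union> cone_lattice_points (5/4 * ?h) (15/8 * ?h) :: 'b set))"
      unfolding T_def
      by (intro of_nat_mono card_mono finite_UnI finite_cone_lattice_points)
        (auto simp: cone_lattice_points_def)
    also have "\<dots> \<le> T (5/4 * ?h) + real (card (cone_lattice_points (5/4 * ?h) (15/8 * ?h) :: 'b set))"
      unfolding T_def of_nat_add[symmetric] by (intro of_nat_mono card_Un_le)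
    also have "\<dots> \<le> A * r ^ j + C * r ^ j" using Suc.IH bd[OF h] hp by simp
    also have "\<dots> \<le> A * r ^ j + A * (r - 1) * r ^ j" using A r by (intro add_left_mono mult_right_mono) auto
    also have "\<dots> = A * r ^ Suc j" by (simp add: algebra_simps)
    finally show ?case unfolding eq .
  qed
  have TX: "T X \<le> A * r * X powr g" if X: "X \<ge> 1" for X
  proof -
    define j where "j = nat \<lceil>log (3/2) X\<rceil>"
    have lg: "log (3/2) X \<ge> 0" using X by simp
    have j: "log (3/2) X \<le> real j" "real j \<le> log (3/2) X + 1" using lg unfolding j_def by linarith+
    have "X = (3/2) powr log (3/2) X" using X by simp
    also have "\<dots> \<le> (3/2) powr real j" using j by (intro powr_mono) auto
    also have "\<dots> = (3/2) ^ j" by (simp add: powr_realpow)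
    finally have "X \<le> (3/2) ^ j" .
    moreover have "(0::real) \<le> (3/2) ^ j" by simp
    ultimately have Xj: "X \<le> 5/4 * (3/2) ^ j" by linarith
    have "r ^ j = r powr real j" using r by (simp add: powr_realpow)
    also have "\<dots> \<le> r powr (log (3/2) X + 1)" using j r by (intro powr_mono) auto
    also have "\<dots> = r * r powr log (3/2) X" using r by (simp add: powr_add)
    also have "r powr log (3/2) X = ((3/2) powr log (3/2) X) powr g"
      unfolding r_def by (simp only: powr_powr mult.commute)
    also have "\<dots> = X powr g" using X by simp
    finally have rj: "r ^ j \<le> r * X powr g" .
    have "T X \<le> A * r ^ j" using Tmono[OF Xj] TH[of j] by linarith
    also have "\<dots> \<le> A * (r * X powr g)" using rj A by (intro mult_left_mono) auto
    finally show ?thesis by (simp add: mult.assoc)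
  qed
  define k where "k = DIM('b) - 1"
  have k: "k \<ge> 1" "g < real k" using dim g by (auto simp: k_def)
  define K where "K = 2 * A * r * real DIM('b) powr g"
  have K0: "K \<ge> 0" unfolding K_def using A r by auto
  define D where "D = 2 * K powr (1 / real k) + 1"
  have pc: "real (card {p::nat. prime p \<and> p \<le> Y}) \<le> D * real Y powr (g / real k)" if Y: "Y \<ge> 1" for Y
  proof -
    define M where "M = real (card {p::nat. prime p \<and> odd p \<and> p \<le> Y})"
    have fin: "finite {p::nat. prime p \<and> odd p \<and> p \<le> Y}"
      by (rule finite_subset[of _ "{..Y}"]) auto
    have "{p::nat. prime p \<and> p \<le> Y} \<subseteq> insert 2 {p::nat. prime p \<and> odd p \<and> p \<le> Y}"
    proof
      fix p :: nat assume "p \<in> {p. prime p \<and> p \<le> Y}"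
      then show "p \<in> insert 2 {p. prime p \<and> odd p \<and> p \<le> Y}"
        using prime_odd_nat[of p] prime_ge_2_nat[of p] by (cases "p = 2") auto
    qed
    then have "card {p::nat. prime p \<and> p \<le> Y} \<le> card (insert 2 {p::nat. prime p \<and> odd p \<and> p \<le> Y})"
      using fin by (intro card_mono) auto
    also have "\<dots> \<le> Suc (card {p::nat. prime p \<and> odd p \<and> p \<le> Y})"
      using fin by (simp add: card_insert_if)
    finally have M1: "real (card {p::nat. prime p \<and> p \<le> Y}) \<le> M + 1" unfolding M_def by linarith
    have dY: "real (DIM('b) * Y) \<ge> 1" using Y DIM_positive[where 'a='b]
      by (metis One_nat_def Suc_leI mult_le_mono nat_mult_1 of_nat_1 of_nat_mono)
    have "(M / 2) ^ k / 2 \<le> T (real (DIM('b) * Y))"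
      using card_cone_lattice_points_ge[OF dim, of Y] unfolding M_def T_def k_def .
    also have "\<dots> \<le> A * r * real (DIM('b) * Y) powr g" by (rule TX[OF dY])
    finally have "(M / 2) ^ k \<le> K * real Y powr g"
      by (simp add: K_def powr_mult algebra_simps)
    then have "((M / 2) ^ k) powr (1 / real k) \<le> (K * real Y powr g) powr (1 / real k)"
      by (intro powr_mono2) (auto simp: M_def)
    also have "((M / 2) ^ k) powr (1 / real k) = M / 2"
    proof (cases "M = 0")
      case False
      moreover have "M \<ge> 0" by (simp only: M_def of_nat_0_le_iff)
      ultimately have "M > 0" by simp
      then show ?thesis using k by (simp add: powr_realpow[symmetric] powr_powr del: powr_realpow)
    qed (use k in auto)
    also have "(K * real Y powr g) powr (1 / real k) = K powr (1 / real k) * real Y powr (g / real k)"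
      using K0 by (simp add: powr_mult powr_powr)
    finally have "M \<le> 2 * K powr (1 / real k) * real Y powr (g / real k)" by simp
    moreover have "1 \<le> real Y powr (g / real k)" using Y g k by (intro ge_one_powr_ge_zero) auto
    ultimately show ?thesis using M1 unfolding D_def by (simp add: distrib_right)
  qed
  have "0 \<le> g / real k" "g / real k < 1" using g k by auto
  from prime_count_not_sublinear[OF this, of D] obtain n :: nat where
    "n \<ge> 1" "D * real (2 * n) powr (g / real k) < real (card {p::nat. prime p \<and> p \<le> 2 * n})" by blast
  with pc[of "2 * n"] show False by linarith
qed

section \<open>Sums of small balls and lower bounds for Fourier transforms\<close>

text \<open>
  Adding the indicators instead of taking the union of the balls makes the measure additive in
  the centres, so that its mass can be computed without knowing the balls to be disjoint.
\<close>
definition sum_of_balls :: "'a set \<Rightarrow> real \<Rightarrow> 'a::euclidean_space measure" where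
  "sum_of_balls Z \<rho> = density lborel (\<lambda>x. \<Sum>z\<in>Z. indicator (ball z \<rho>) x)"

lemma borel_measurable_ball_indicators:
  "(\<lambda>x. \<Sum>z\<in>Z. indicator (ball (z::'a::euclidean_space) \<rho>) x :: ennreal) \<in> borel_measurable borel"
  by (intro borel_measurable_sum borel_measurable_indicator) auto

lemma emeasure_sum_of_balls:
  assumes "A \<in> sets borel"
  shows "emeasure (sum_of_balls Z \<rho>) A = (\<Sum>z\<in>Z. emeasure lborel (A \<inter> ball z \<rho>))"
proof -
  have "emeasure (sum_of_balls Z \<rho>) A = (\<integral>\<^sup>+x. (\<Sum>z\<in>Z. indicator (A \<inter> ball z \<rho>) x) \<partial>lborel)"
    unfolding sum_of_balls_def using assms
    by (subst emeasure_density) (auto intro!: nn_integral_cong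
      simp: borel_measurable_ball_indicators sum_distrib_left indicator_inter_arith mult.commute[of _ "indicator A _"])
  also have "\<dots> = (\<Sum>z\<in>Z. \<integral>\<^sup>+x. indicator (A \<inter> ball z \<rho>) x \<partial>lborel)"
    using assms by (intro nn_integral_sum borel_measurable_indicator) auto
  also have "\<dots> = (\<Sum>z\<in>Z. emeasure lborel (A \<inter> ball z \<rho>))"
    using assms by simp
  finally show ?thesis .
qed

lemma emeasure_sum_of_balls_UNIV:
  assumes "\<rho> \<ge> 0"
  shows "emeasure (sum_of_balls (Z::'a::euclidean_space set) \<rho>) UNIV
    = ennreal (real (card Z) * (unit_ball_vol (real DIM('a)) * \<rho> ^ DIM('a)))"
  using assms
  by (subst emeasure_sum_of_balls) (simp_all add: emeasure_ball ennreal_mult ennreal_of_nat_eq_real_of_nat)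

lemma AE_sum_of_balls: "AE x in sum_of_balls Z \<rho>. \<exists>z\<in>Z. x \<in> ball z \<rho>"
proof -
  have "(\<Sum>z\<in>Z. indicator (ball z \<rho>) x) = (0::ennreal)" if "\<not> (\<exists>z\<in>Z. x \<in> ball z \<rho>)" for x
    using that by (intro sum.neutral) (auto simp: indicator_def)
  then have pos: "0 < (\<Sum>z\<in>Z. indicator (ball z \<rho>) x :: ennreal) \<longrightarrow> (\<exists>z\<in>Z. x \<in> ball z \<rho>)" for x
    by (metis less_irrefl)
  have "(\<lambda>x. \<Sum>z\<in>Z. indicator (ball z \<rho>) x :: ennreal) \<in> borel_measurable lborel"
    using borel_measurable_ball_indicators by simp
  then show ?thesis unfolding sum_of_balls_def using pos by (subst AE_density) (auto intro!: AE_I2 simp del: mem_ball)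
qed

text \<open>
  A test ball meets only the balls with centre at distance less than \<open>\<rho> + r\<close>, and each of them in a
  set that lies in a ball of radius \<open>min \<rho> r\<close>.
\<close>
lemma emeasure_sum_of_balls_ball_le:
  fixes Z :: "'a::euclidean_space set"
  assumes "finite Z" "\<rho> \<ge> 0" "r \<ge> 0"
  shows "emeasure (sum_of_balls Z \<rho>) (ball x r)
    \<le> ennreal (real (card {z \<in> Z. dist z x < \<rho> + r}) * (unit_ball_vol (real DIM('a)) * min \<rho> r ^ DIM('a)))"
proof -
  let ?W = "{z \<in> Z. dist z x < \<rho> + r}" and ?v = "ennreal (unit_ball_vol (real DIM('a)) * min \<rho> r ^ DIM('a))"
  have "emeasure (sum_of_balls Z \<rho>) (ball x r) = (\<Sum>z\<in>Z. emeasure lborel (ball x r \<inter> ball z \<rho>))"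
    by (rule emeasure_sum_of_balls) simp
  also have "\<dots> = (\<Sum>z\<in>?W. emeasure lborel (ball x r \<inter> ball z \<rho>))"
  proof (rule sum.mono_neutral_right)
    show "\<forall>z\<in>Z - ?W. emeasure lborel (ball x r \<inter> ball z \<rho>) = 0"
    proof
      fix z assume "z \<in> Z - ?W"
      then have "\<rho> + r \<le> dist z x" by auto
      then have "ball x r \<inter> ball z \<rho> = {}"
        by (auto simp: dist_commute) (metis add.commute add_strict_mono dist_commute dist_triangle_lt leD)
      then show "emeasure lborel (ball x r \<inter> ball z \<rho>) = 0" by simp
    qed
  qed (use assms in auto)
  also have "\<dots> \<le> (\<Sum>z\<in>?W. ?v)"
  proof (rule sum_mono)
    fix z
    have "emeasure lborel (ball x r \<inter> ball z \<rho>) \<le> emeasure lborel (ball (if \<rho> \<le> r then z else x) (min \<rho> r))"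
      by (intro emeasure_mono) auto
    also have "\<dots> = ?v" using assms by (simp add: emeasure_ball)
    finally show "emeasure lborel (ball x r \<inter> ball z \<rho>) \<le> ?v" .
  qed
  also have "\<dots> = ennreal (real (card ?W) * (unit_ball_vol (real DIM('a)) * min \<rho> r ^ DIM('a)))"
    using assms by (simp add: ennreal_mult ennreal_of_nat_eq_real_of_nat)
  finally show ?thesis .
qed

text \<open>
  The integrand has real part \<open>cos (2 \<pi> \<langle>\<xi>, x\<rangle>) \<ge> 1/2\<close> almost everywhere, so no cancellation occurs.
\<close>
lemma fourier_measure_lower_bound:
  fixes \<mu> :: "'a::euclidean_space measure"
  assumes "finite_measure \<mu>" and sets: "sets \<mu> = sets borel"
    and AE: "AE x in \<mu>. 1 / 2 \<le> cos (2 * pi * (\<xi> \<bullet> x))"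
  shows "measure \<mu> UNIV / 2 \<le> cmod (fourier_measure \<mu> \<xi>)"
proof -
  interpret finite_measure \<mu> by fact
  have sp: "space \<mu> = UNIV" using sets sets_eq_imp_space_eq by fastforce
  have m: "(\<lambda>x. exp (- (2 * pi * (\<xi> \<bullet> x)) * \<i>)) \<in> borel_measurable \<mu>"
    unfolding measurable_cong_sets[OF sets refl] by measurable
  have e: "exp (- (2 * pi * (\<xi> \<bullet> x)) * \<i>) = cis (- (2 * pi * (\<xi> \<bullet> x)))" for x
    by (simp add: cis_conv_exp mult.commute)
  have re: "Re (exp (- (2 * pi * (\<xi> \<bullet> x)) * \<i>)) = cos (2 * pi * (\<xi> \<bullet> x))" for x
    unfolding e by simp
  have int: "integrable \<mu> (\<lambda>x. exp (- (2 * pi * (\<xi> \<bullet> x)) * \<i>))"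
    using m by (intro integrable_const_bound[of _ 1]) (auto simp only: e norm_cis intro!: AE_I2)
  have "measure \<mu> UNIV / 2 = (LINT x|\<mu>. 1 / 2)" using sp by simp
  also have "\<dots> \<le> (LINT x|\<mu>. Re (exp (- (2 * pi * (\<xi> \<bullet> x)) * \<i>)))"
  proof (rule integral_mono_AE)
    show "integrable \<mu> (\<lambda>x. Re (exp (- (2 * pi * (\<xi> \<bullet> x)) * \<i>)))" using int by (rule integrable_Re)
    show "AE x in \<mu>. 1 / 2 \<le> Re (exp (- (2 * pi * (\<xi> \<bullet> x)) * \<i>))" using AE unfolding re .
  qed simp
  also have "\<dots> = Re (fourier_measure \<mu> \<xi>)" unfolding fourier_measure_def using int by (rule integral_Re)
  also have "\<dots> \<le> cmod (fourier_measure \<mu> \<xi>)" by (rule complex_Re_le_cmod)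
  finally show ?thesis .
qed

lemma cos_near_integer_ge_half:
  assumes "k \<in> \<int>" "\<bar>y - k\<bar> \<le> 1 / 6"
  shows "1 / 2 \<le> cos (2 * pi * y)"
proof -
  obtain n where n: "k = real_of_int n" using assms by (auto elim: Ints_cases)
  have "cos (2 * pi * y) = cos (2 * pi * (y - k) + 2 * pi * real_of_int n)" by (simp add: n algebra_simps)
  also have "\<dots> = cos (2 * pi * (y - k))" by (simp add: cos_add)
  also have "\<dots> = cos \<bar>2 * pi * (y - k)\<bar>" by (simp only: cos_abs_real)
  finally have eq: "cos (2 * pi * y) = cos \<bar>2 * pi * (y - k)\<bar>" .
  have "\<bar>2 * pi * (y - k)\<bar> = 2 * pi * \<bar>y - k\<bar>" by (simp add: abs_mult)
  also have "\<dots> \<le> 2 * pi * (1 / 6)" using assms(2) by (intro mult_left_mono) auto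
  finally have "\<bar>2 * pi * (y - k)\<bar> \<le> pi / 3" by simp
  then have "cos (pi / 3) \<le> cos \<bar>2 * pi * (y - k)\<bar>" by (intro cos_monotone_0_pi_le) auto
  then show ?thesis unfolding eq by (simp add: cos_60)
qed

section \<open>A measure of dimension $\alpha$ near a scaled lattice\<close>

text \<open>
  Up to constants, the fraction of the mass in a ball
  of radius \<open>r\<close> is the \<open>n\<close>-th power of \<open>(r + \<rho> + s) min (r / \<rho>) 1\<close>.  Here
  \<open>s\<^sup>n = R powr (- \<alpha>)\<close> is comparable to \<open>\<rho> powr \<alpha>\<close>.  Inside one ball \<open>(r \<le> \<rho>)\<close> the
  fraction is \<open>s\<^sup>n (r / \<rho>)\<^sup>n \<le> s\<^sup>n (r / \<rho>) powr \<alpha>\<close>, between the two scales it stays \<open>s\<^sup>n\<close>, and beyond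
  the lattice spacing it is \<open>r\<^sup>n \<le> r powr \<alpha>\<close>.
\<close>
lemma lattice_scale_bound:
  fixes n :: nat and \<alpha> R r :: real
  assumes n: "n > 0" and \<alpha>: "0 < \<alpha>" "\<alpha> < real n" and R: "R \<ge> 1" and r: "0 < r" "r \<le> 1"
  defines "s \<equiv> R powr (- \<alpha> / real n)" and "\<rho> \<equiv> 1 / (48 * R)"
  shows "((2 * (\<rho> + r) + s) * min \<rho> r) ^ n \<le> 5 ^ n * 48 powr \<alpha> * r powr \<alpha> * \<rho> ^ n"
proof -
  have \<rho>: "\<rho> > 0" and R0: "R > 0" using R by (auto simp: \<rho>_def)
  have s0: "s > 0" using R by (simp add: s_def)
  have sn: "s ^ n = R powr (- \<alpha>)" using n R0 s0 by (simp add: s_def powr_realpow[symmetric] powr_powr del: powr_realpow)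
  have \<rho>s: "\<rho> \<le> s"
  proof -
    have "\<rho> \<le> R powr (- 1)" using R by (simp add: \<rho>_def powr_minus field_simps)
    also have "\<dots> \<le> s" unfolding s_def using R \<alpha> n by (intro powr_mono) (auto simp: field_simps)
    finally show ?thesis .
  qed
  have R\<rho>: "R powr (- \<alpha>) = 48 powr \<alpha> * \<rho> powr \<alpha>"
    using R0 by (simp add: \<rho>_def powr_divide powr_mult powr_minus field_simps)
  consider "r \<le> \<rho>" | "\<rho> < r" "r \<le> s" | "\<rho> < r" "s < r" by linarith
  then show ?thesis
  proof cases
    case 1
    have "((2 * (\<rho> + r) + s) * min \<rho> r) ^ n \<le> (5 * s * r) ^ n"
      using 1 \<rho>s \<rho> r s0 by (intro power_mono mult_mono) auto
    also have "\<dots> = 5 ^ n * 48 powr \<alpha> * (\<rho> powr \<alpha> * r ^ n)" by (simp add: power_mult_distrib sn R\<rho>)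
    also have "\<rho> powr \<alpha> * r ^ n \<le> r powr \<alpha> * \<rho> ^ n"
    proof -
      have "r powr (real n - \<alpha>) \<le> \<rho> powr (real n - \<alpha>)" using 1 r \<alpha> by (intro powr_mono2) auto
      then show ?thesis using r \<rho> by (simp add: powr_diff powr_realpow field_simps)
    qed
    finally show ?thesis by (simp add: mult.assoc)
  next
    case 2
    have "((2 * (\<rho> + r) + s) * min \<rho> r) ^ n \<le> (5 * s * \<rho>) ^ n"
      using 2 \<rho>s \<rho> r s0 by (intro power_mono mult_mono) auto
    also have "\<dots> = 5 ^ n * 48 powr \<alpha> * \<rho> powr \<alpha> * \<rho> ^ n" by (simp add: power_mult_distrib sn R\<rho>)
    also have "\<dots> \<le> 5 ^ n * 48 powr \<alpha> * r powr \<alpha> * \<rho> ^ n"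
      using 2 \<rho> \<alpha> by (intro mult_right_mono mult_left_mono powr_mono2) auto
    finally show ?thesis .
  next
    case 3
    have "((2 * (\<rho> + r) + s) * min \<rho> r) ^ n \<le> (5 * r * \<rho>) ^ n"
      using 3 \<rho>s \<rho> r s0 by (intro power_mono mult_mono) auto
    also have "\<dots> = 5 ^ n * 1 * r powr real n * \<rho> ^ n" using r by (simp add: power_mult_distrib powr_realpow)
    also have "\<dots> \<le> 5 ^ n * 48 powr \<alpha> * r powr \<alpha> * \<rho> ^ n"
      using r \<rho> \<alpha> ge_one_powr_ge_zero[of 48 \<alpha>]
      by (intro mult_right_mono mult_mono mult_left_mono powr_mono') auto
    finally show ?thesis .
  qed
qed

text \<open>
  Balls of radius above \<open>1\<close> are harmless: there the total mass is already a sufficient bound.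
\<close>
lemma c_dim_le:
  fixes \<mu> :: "'a::euclidean_space measure"
  assumes M: "emeasure \<mu> UNIV = ennreal M" "M \<ge> 0" and K: "K \<ge> 1" and \<alpha>: "\<alpha> > 0" and sets: "sets \<mu> = sets borel"
    and small: "\<And>x r. 0 < r \<Longrightarrow> r \<le> 1 \<Longrightarrow> emeasure \<mu> (ball x r) \<le> ennreal (K * M * r powr \<alpha>)"
  shows "c_dim \<alpha> \<mu> \<le> ennreal (K * M)"
  unfolding c_dim_def
proof (rule SUP_least, clarify)
  fix x :: 'a and r :: real assume r: "r > 0"
  have "emeasure \<mu> (ball x r) \<le> ennreal (K * M * r powr \<alpha>)"
  proof (cases "r \<le> 1")
    case False
    have "emeasure \<mu> (ball x r) \<le> emeasure \<mu> UNIV" using sets by (intro emeasure_mono) (auto simp: sets_eq_imp_space_eq[OF sets])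
    also have "\<dots> \<le> ennreal (K * M * r powr \<alpha>)"
    proof -
      have "M * 1 \<le> (K * M) * r powr \<alpha>"
        using False M K \<alpha> by (intro mult_mono ge_one_powr_ge_zero) (auto simp: mult_le_cancel_right1)
      then show ?thesis unfolding M by (intro ennreal_leI) simp
    qed
    finally show ?thesis .
  qed (use small r in auto)
  then have "emeasure \<mu> (ball x r) / ennreal (r powr \<alpha>) \<le> ennreal (K * M * r powr \<alpha>) / ennreal (r powr \<alpha>)"
    by (rule divide_right_mono_ennreal)
  also have "\<dots> = ennreal (K * M)" using r K M by (subst divide_ennreal) auto
  finally show "emeasure \<mu> (ball x r) / ennreal (r powr \<alpha>) \<le> ennreal (K * M)" .
qed

text \<open>
  The test measure.  Its centres \<open>s z\<close> fill the cube of half-side \<open>1 / (2 n)\<close>, which lies in the ball of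
  radius \<open>1/2\<close>; the radius \<open>1 / (48 R)\<close> is small enough that the phase of a frequency of size
  at most \<open>4 R\<close> varies by at most \<open>1/12\<close> between a point of a ball and its centre.
\<close>
lemma lattice_measure:
  fixes \<alpha> R :: real
  assumes \<alpha>: "0 < \<alpha>" "\<alpha> < real DIM('a::euclidean_space)" and R: "R \<ge> 1"
  defines "s \<equiv> R powr (- \<alpha> / real DIM('a::euclidean_space))"
  obtains \<mu> :: "'a::euclidean_space measure" and M where
    "\<mu> \<in> ball_measures" "M > 0" "emeasure \<mu> UNIV = ennreal M"
    "c_dim \<alpha> \<mu> \<le> ennreal ((10 * real DIM('a::euclidean_space)) ^ DIM('a::euclidean_space) * 48 powr \<alpha> * M)"
    "AE x in \<mu>. \<exists>z\<in>int_lattice. norm (s *\<^sub>R z) \<le> 1 / 2 \<and> norm (x - s *\<^sub>R z) \<le> 1 / (48 * R)"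
proof -
  define n where "n = DIM('a)"
  define \<rho> where "\<rho> = 1 / (48 * R)"
  define V where "V = unit_ball_vol (real n)"
  define L where "L = 1 / (2 * real n * s)"
  define B where "B = {z::'a \<in> int_lattice. \<forall>b\<in>Basis. z \<bullet> b \<in> {- L..L}}"
  define Z where "Z = (\<lambda>z. s *\<^sub>R z) ` B"
  define \<mu> where "\<mu> = sum_of_balls Z \<rho>"
  define M where "M = real (card Z) * (V * \<rho> ^ n)"
  define K where "K = (10 * real n) ^ n * 48 powr \<alpha>"
  have n: "n > 0" "\<alpha> < real n" using \<alpha> by (auto simp: n_def)
  have \<rho>: "0 < \<rho>" "\<rho> \<le> 1 / 2" using R by (auto simp: \<rho>_def field_simps)
  have s: "s > 0" using R by (simp add: s_def)
  have V: "V > 0" by (simp add: V_def)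
  have L: "L > 0" using s n by (simp add: L_def)
  have finB: "finite B" unfolding B_def by (rule finite_int_lattice_box) simp
  have finZ: "finite Z" using finB by (simp add: Z_def)
  have cZB: "card Z = card B" unfolding Z_def using s by (intro card_image inj_onI) simp
  have cZ: "L ^ n \<le> real (card Z)"
    unfolding cZB n_def B_def using L by (intro card_int_lattice_box_ge) simp
  have M: "M > 0" "L ^ n * (V * \<rho> ^ n) \<le> M"
  proof -
    show "L ^ n * (V * \<rho> ^ n) \<le> M" unfolding M_def using cZ V \<rho> by (intro mult_right_mono) auto
    moreover have "0 < L ^ n * (V * \<rho> ^ n)" using L V \<rho> by simp
    ultimately show "M > 0" by linarith
  qed
  have nZ: "norm z \<le> 1 / 2" if z: "z \<in> Z" for z
  proof -
    have "norm z \<le> (\<Sum>b\<in>Basis. \<bar>z \<bullet> b\<bar>)" by (rule norm_le_l1)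
    also have "\<dots> \<le> (\<Sum>b\<in>(Basis::'a set). s * L)"
      using z s by (intro sum_mono) (auto simp: Z_def B_def abs_mult intro!: mult_left_mono)
    also have "\<dots> = 1 / 2" using s n by (simp add: L_def n_def[symmetric])
    finally show ?thesis .
  qed
  have sets: "sets \<mu> = sets borel" by (simp add: \<mu>_def sum_of_balls_def)
  have em: "emeasure \<mu> UNIV = ennreal M"
    unfolding \<mu>_def M_def V_def n_def using \<rho> by (intro emeasure_sum_of_balls_UNIV) simp
  have "emeasure \<mu> (- cball 0 1) = (\<Sum>z\<in>Z. emeasure lborel (- cball 0 1 \<inter> ball z \<rho>))"
    unfolding \<mu>_def by (rule emeasure_sum_of_balls) simp
  also have "\<dots> = 0"
  proof (intro sum.neutral ballI)
    fix z assume z: "z \<in> Z"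
    have "- cball 0 1 \<inter> ball z \<rho> = {}"
    proof -
      have "norm x \<le> 1" if "dist z x < \<rho>" for x
        using nZ[OF z] \<rho> that norm_triangle_sub[of x z] by (simp add: dist_norm norm_minus_commute)
      then show ?thesis by auto
    qed
    then show "emeasure lborel (- cball 0 1 \<inter> ball z \<rho>) = 0" by simp
  qed
  finally have out: "emeasure \<mu> (- cball 0 1) = 0" .
  have fin: "finite_measure \<mu>"
    by (rule finite_measureI) (simp add: sets_eq_imp_space_eq[OF sets] em)
  have bm: "\<mu> \<in> ball_measures" using sets fin out by (simp add: ball_measures_def)
  have cd: "c_dim \<alpha> \<mu> \<le> ennreal (K * M)"
  proof (rule c_dim_le[OF em _ _ \<alpha>(1) sets])
    show "K \<ge> 1" unfolding K_def
      using n \<alpha> by (intro mult_ge1_I one_le_power ge_one_powr_ge_zero) auto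
    fix x :: 'a and r :: real assume r: "0 < r" "r \<le> 1"
    let ?W = "{z \<in> Z. dist z x < \<rho> + r}"
    \<comment> \<open>The lattice points whose balls meet the test ball lie in a cube of half-side \<open>L'\<close>.\<close>
    define L' where "L' = (\<rho> + r) / s"
    define B' where "B' = {z::'a \<in> int_lattice. \<forall>b\<in>Basis. z \<bullet> b \<in> {(x /\<^sub>R s) \<bullet> b - L'..(x /\<^sub>R s) \<bullet> b + L'}}"
    have L': "L' \<ge> 0" using \<rho> r s by (simp add: L'_def)
    have "?W \<subseteq> (\<lambda>z. s *\<^sub>R z) ` B'"
    proof
      fix y assume "y \<in> ?W"
      then obtain z where z: "z \<in> int_lattice" "y = s *\<^sub>R z" "dist y x < \<rho> + r" by (auto simp: Z_def B_def)
      have "\<bar>z \<bullet> b - (x /\<^sub>R s) \<bullet> b\<bar> \<le> L'" if b: "b \<in> Basis" for b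
      proof -
        have "s * \<bar>z \<bullet> b - (x /\<^sub>R s) \<bullet> b\<bar> = \<bar>s * (z \<bullet> b - (x /\<^sub>R s) \<bullet> b)\<bar>" using s by (simp add: abs_mult)
        also have "s * (z \<bullet> b - (x /\<^sub>R s) \<bullet> b) = (y - x) \<bullet> b"
          using s by (simp add: z inner_diff_left algebra_simps)
        also have "\<bar>(y - x) \<bullet> b\<bar> \<le> norm (y - x)" using b by (rule Basis_le_norm)
        also have "\<dots> \<le> \<rho> + r" using z by (simp add: dist_norm)
        finally show ?thesis using s by (simp add: L'_def pos_le_divide_eq mult.commute)
      qed
      then have "z \<in> B'" using z(1) by (auto simp: B'_def abs_le_iff algebra_simps)
      then show "y \<in> (\<lambda>z. s *\<^sub>R z) ` B'" using z(2) by blast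
    qed
    then have "card ?W \<le> card B'"
      using finite_int_lattice_box[of "\<lambda>b. {(x /\<^sub>R s) \<bullet> b - L'..(x /\<^sub>R s) \<bullet> b + L'}"]
      by (intro surj_card_le) (auto simp: B'_def)
    also have "real (card B') \<le> (2 * L' + 1) ^ n" unfolding B'_def n_def by (rule card_int_lattice_box_le[OF L'])
    finally have cW: "real (card ?W) \<le> (2 * L' + 1) ^ n" by simp
    have "real (card ?W) * (V * min \<rho> r ^ n) \<le> (2 * L' + 1) ^ n * (V * min \<rho> r ^ n)"
      using cW V \<rho> r by (intro mult_right_mono) auto
    also have "2 * L' + 1 = (2 * (\<rho> + r) + s) / s" using s by (simp add: L'_def field_simps)
    also have "((2 * (\<rho> + r) + s) / s) ^ n * (V * min \<rho> r ^ n)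
        = V * ((2 * (\<rho> + r) + s) * min \<rho> r) ^ n / s ^ n"
      by (simp add: power_mult_distrib power_divide)
    also have "\<dots> \<le> V * (5 ^ n * 48 powr \<alpha> * r powr \<alpha> * \<rho> ^ n) / s ^ n"
      using lattice_scale_bound[OF n(1) \<alpha>(1) n(2) R r] V s
      unfolding s_def n_def[symmetric] \<rho>_def
      by (intro divide_right_mono mult_left_mono) auto
    also have "\<dots> = K * r powr \<alpha> * (L ^ n * (V * \<rho> ^ n))"
    proof -
      have "10 * real n * L = 5 / s" using n s by (simp add: L_def)
      then have KL: "(10 * real n) ^ n * L ^ n = 5 ^ n / s ^ n"
        by (simp only: power_mult_distrib[symmetric] power_divide[symmetric])
      have "V * (5 ^ n * 48 powr \<alpha> * r powr \<alpha> * \<rho> ^ n) / s ^ n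
          = (5 ^ n / s ^ n) * 48 powr \<alpha> * r powr \<alpha> * (V * \<rho> ^ n)" by simp
      also have "\<dots> = K * r powr \<alpha> * (L ^ n * (V * \<rho> ^ n))"
        unfolding KL[symmetric] K_def by (simp only: mult_ac)
      finally show ?thesis .
    qed
    also have "\<dots> \<le> K * r powr \<alpha> * M"
      using M(2) by (intro mult_left_mono) (auto simp: K_def)
    finally have "real (card ?W) * (V * min \<rho> r ^ n) \<le> K * M * r powr \<alpha>" by (simp add: mult_ac)
    then show "emeasure \<mu> (ball x r) \<le> ennreal (K * M * r powr \<alpha>)"
      using emeasure_sum_of_balls_ball_le[OF finZ, of \<rho> r x] \<rho> r unfolding \<mu>_def V_def n_def
      by (meson ennreal_leI less_imp_le order_trans)
  qed (use M in simp)
  have "AE x in \<mu>. \<exists>z\<in>int_lattice. norm (s *\<^sub>R z) \<le> 1 / 2 \<and> norm (x - s *\<^sub>R z) \<le> 1 / (48 * R)"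
    using AE_sum_of_balls[of Z \<rho>] unfolding \<mu>_def[symmetric]
  proof eventually_elim
    case (elim x)
    then obtain y where y: "y \<in> Z" "dist y x < \<rho>" by auto
    then obtain z where z: "z \<in> int_lattice" "y = s *\<^sub>R z" by (auto simp: Z_def B_def)
    have "norm (x - s *\<^sub>R z) \<le> 1 / (48 * R)" using y z by (simp add: dist_norm norm_minus_commute \<rho>_def)
    then show ?case using nZ[OF y(1)] z by blast
  qed
  with bm M(1) em cd that[of \<mu> M] show ?thesis unfolding K_def n_def by blast
qed

section \<open>Fourier decay bounds the number of integer points on the cone\<close>

lemma cone_point_in_int_lattice:
  "w \<in> int_lattice \<Longrightarrow> norm w \<in> \<int> \<Longrightarrow> (w, norm w) \<in> int_lattice"
  by (auto simp: int_lattice_def Basis_prod_def)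

text \<open>
  Write \<open>\<eta> = R (\<xi>, \<bar>\<xi>\<bar>)\<close> as the dual lattice point \<open>s\<^sup>-\<^sup>1 (w, \<bar>w\<bar>)\<close> plus an error \<open>\<theta>\<close> of norm at most
  \<open>1/12\<close>.  The phase \<open>\<langle>\<eta>, x\<rangle>\<close> at a point \<open>x\<close> near \<open>s z\<close> is the integer \<open>\<langle>(w, \<bar>w\<bar>), z\<rangle>\<close> up to the two
  errors \<open>\<langle>\<theta>, s z\<rangle>\<close> and \<open>\<langle>\<eta>, x - s z\<rangle>\<close>, each at most \<open>1/12\<close>.
\<close>
lemma fourier_large_near_cone_point:
  fixes w \<xi> :: "'b::euclidean_space" and \<mu> :: "('b \<times> real) measure"
  assumes \<mu>: "finite_measure \<mu>" "sets \<mu> = sets borel" and R: "R > 0" and s: "s > 0"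
    and AE: "AE x in \<mu>. \<exists>z\<in>int_lattice. norm (s *\<^sub>R z) \<le> 1 / 2 \<and> norm (x - s *\<^sub>R z) \<le> 1 / (48 * R)"
    and w: "w \<in> int_lattice" "norm w \<in> \<int>"
    and \<xi>: "norm \<xi> \<le> 2" "norm (\<xi> - w /\<^sub>R (s * R)) \<le> 1 / (24 * R)"
  shows "measure \<mu> UNIV / 2 \<le> cmod (fourier_measure \<mu> (R *\<^sub>R (\<xi>, norm \<xi>)))"
proof (rule fourier_measure_lower_bound[OF \<mu>])
  let ?\<eta> = "R *\<^sub>R (\<xi>, norm \<xi>)" and ?w = "(w, norm w)"
  define \<theta> where "\<theta> = ?\<eta> - ?w /\<^sub>R s"
  have a: "norm (R *\<^sub>R \<xi> - w /\<^sub>R s) \<le> 1 / 24"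
  proof -
    have "R *\<^sub>R \<xi> - w /\<^sub>R s = R *\<^sub>R (\<xi> - w /\<^sub>R (s * R))" using R by (simp add: algebra_simps)
    then have "norm (R *\<^sub>R \<xi> - w /\<^sub>R s) = R * norm (\<xi> - w /\<^sub>R (s * R))" using R by simp
    also have "\<dots> \<le> R * (1 / (24 * R))" using \<xi>(2) R by (intro mult_left_mono) auto
    finally show ?thesis using R by simp
  qed
  have b: "\<bar>R * norm \<xi> - norm w / s\<bar> \<le> 1 / 24"
  proof -
    have "\<bar>norm (R *\<^sub>R \<xi>) - norm (w /\<^sub>R s)\<bar> \<le> norm (R *\<^sub>R \<xi> - w /\<^sub>R s)" by (rule norm_triangle_ineq3)
    moreover have "norm (R *\<^sub>R \<xi>) = R * norm \<xi>" using R by simp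
    moreover have "norm (w /\<^sub>R s) = norm w / s" using s by (simp add: divide_inverse_commute)
    ultimately show ?thesis using a by linarith
  qed
  have "\<theta> = (R *\<^sub>R \<xi> - w /\<^sub>R s, R * norm \<xi> - norm w / s)" by (simp add: \<theta>_def divide_inverse mult.commute)
  then have \<theta>: "norm \<theta> \<le> 1 / 12" using norm_Pair_le[of "R *\<^sub>R \<xi> - w /\<^sub>R s" "R * norm \<xi> - norm w / s"] a b by simp
  have \<eta>: "norm ?\<eta> \<le> 4 * R"
  proof -
    have "norm ?\<eta> = R * norm (\<xi>, norm \<xi>)"
      using norm_scaleR[of R "(\<xi>, norm \<xi>)"] R by (simp only: abs_of_pos)
    also have "\<dots> \<le> R * 4" using norm_Pair_le[of \<xi> "norm \<xi>"] \<xi>(1) R by (intro mult_left_mono) auto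
    finally show ?thesis by simp
  qed
  show "AE x in \<mu>. 1 / 2 \<le> cos (2 * pi * (?\<eta> \<bullet> x))"
    using AE
  proof eventually_elim
    case (elim x)
    then obtain z where z: "z \<in> int_lattice" "norm (s *\<^sub>R z) \<le> 1 / 2" "norm (x - s *\<^sub>R z) \<le> 1 / (48 * R)" by blast
    have "?\<eta> \<bullet> x - ?w \<bullet> z = \<theta> \<bullet> (s *\<^sub>R z) + ?\<eta> \<bullet> (x - s *\<^sub>R z)"
      using s by (simp only: \<theta>_def inner_diff_left inner_diff_right inner_scaleR_left inner_scaleR_right)
        (simp add: algebra_simps)
    also have "\<bar>\<dots>\<bar> \<le> norm \<theta> * norm (s *\<^sub>R z) + norm ?\<eta> * norm (x - s *\<^sub>R z)"
      by (intro order.trans[OF abs_triangle_ineq] add_mono Cauchy_Schwarz_ineq2)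
    also have "\<dots> \<le> 1 / 12 * 1 + (4 * R) * (1 / (48 * R))"
      using \<theta> \<eta> z R by (intro add_mono mult_mono) auto
    also have "\<dots> = 1 / 6" using R by simp
    finally show ?case
      by (intro cos_near_integer_ge_half[of "?w \<bullet> z"] inner_int_lattice cone_point_in_int_lattice w z)
  qed
qed

text \<open>
  The lower bound is only available on the cone itself, so the comparison function must be
  supported on the part of the cone above \<open>E\<close> and not on the cylinder over \<open>E\<close>.
\<close>
lemma nn_integral_cone_measure_ge:
  fixes E :: "'b::euclidean_space set" and f :: "'b \<times> real \<Rightarrow> ennreal"
  assumes E: "open E" and "\<And>\<xi>. \<xi> \<in> E \<Longrightarrow> 1 \<le> norm \<xi> \<and> norm \<xi> \<le> 2 \<and> c \<le> f (\<xi>, norm \<xi>)"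
  shows "c * emeasure lborel E \<le> (\<integral>\<^sup>+p. f p \<partial>cone_measure)"
proof -
  define A :: "('b \<times> real) set" where "A = {p. fst p \<in> E \<and> snd p = norm (fst p)}"
  have A: "A \<in> sets borel"
  proof -
    have "A = (E \<times> UNIV) \<inter> {p. snd p = norm (fst p)}" by (auto simp: A_def)
    moreover have "open (E \<times> (UNIV :: real set))" using E by (intro open_Times) auto
    moreover have "closed {p :: 'b \<times> real. snd p = norm (fst p)}" by (intro closed_Collect_eq continuous_intros)
    ultimately show ?thesis by auto
  qed
  have sets: "sets (cone_measure :: ('b \<times> real) measure) = sets borel" by (simp add: cone_measure_def)
  have "{\<xi>. 1 \<le> norm \<xi> \<and> norm \<xi> \<le> 2 \<and> (\<xi>, norm \<xi>) \<in> A} = E" using assms(2) by (auto simp: A_def)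
  then have "c * emeasure lborel E = c * emeasure cone_measure A" by (simp add: emeasure_cone_measure[OF A])
  also have "\<dots> = (\<integral>\<^sup>+p. c * indicator A p \<partial>cone_measure)" using A sets by (simp add: nn_integral_cmult_indicator)
  also have "\<dots> \<le> (\<integral>\<^sup>+p. f p \<partial>cone_measure)"
    using assms(2) by (intro nn_integral_mono) (auto simp: A_def indicator_def)
  finally show ?thesis .
qed

text \<open>
  Choose \<open>R\<close> with \<open>s R = h\<close>.  The integer points \<open>w\<close> in the shell become the centres \<open>w / h\<close> of disjoint
  balls of radius \<open>\<epsilon>\<close>, proportional to \<open>1 / R\<close>, in the annulus from \<open>1\<close> to \<open>2\<close>.  On the part of the
  cone above them the Fourier transform of the lattice measure at scale \<open>R\<close> is at least half its mass
  in modulus.  Comparing the volume of these balls with the decay estimate bounds their number.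
\<close>
lemma shell_count_le_of_decay_estimate:
  fixes \<alpha> \<beta> C :: real
  defines "d \<equiv> DIM('b::euclidean_space)"
  defines "\<kappa> \<equiv> \<alpha> / (real d + 1)"
  assumes \<alpha>: "0 < \<alpha>" "\<alpha> < real d + 1" and C: "C > 0"
    and dec: "decay_estimate (cone_measure :: ('b::euclidean_space \<times> real) measure) \<alpha> \<beta> C"
  shows "\<exists>C'. \<forall>h\<ge>1. real (card (cone_lattice_points (5/4 * h) (15/8 * h) :: 'b::euclidean_space set))
    \<le> C' * h powr ((real d - \<beta>) / (1 - \<kappa>))"
proof (intro exI allI impI)
  fix h :: real assume h: "h \<ge> 1"
  have \<kappa>: "0 < \<kappa>" "\<kappa> < 1" using \<alpha> by (auto simp: \<kappa>_def)
  define K where "K = (10 * (real d + 1)) ^ (d + 1) * 48 powr \<alpha>"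
  define V where "V = unit_ball_vol (real d)"
  define R where "R = h powr (1 / (1 - \<kappa>))"
  define s where "s = R powr (- \<kappa>)"
  have R: "R \<ge> 1" "R > 0" using h \<kappa> ge_one_powr_ge_zero[of h "1 / (1 - \<kappa>)"] by (auto simp: R_def)
  have s: "s > 0" using R by (simp add: s_def)
  have sR: "s * R = h"
  proof -
    have "s * R = R powr (1 - \<kappa>)" using R by (simp add: s_def powr_diff powr_minus divide_inverse)
    then show ?thesis using \<kappa> h by (simp add: R_def powr_powr)
  qed
  have hR: "h \<le> R" using sR R s \<kappa> powr_mono[of "- \<kappa>" 0 R] mult_right_mono[of s 1 R] by (simp add: s_def)
  define P where "P = (cone_lattice_points (5/4 * h) (15/8 * h) :: 'b set)"
  have DIM: "real DIM('b \<times> real) = real d + 1" "DIM('b \<times> real) = d + 1" by (simp_all add: d_def)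
  have \<alpha>': "\<alpha> < real DIM('b \<times> real)" unfolding DIM using \<alpha> by simp
  have s': "s = R powr (- \<alpha> / real DIM('b \<times> real))" unfolding DIM s_def \<kappa>_def by (simp add: add.commute)
  obtain \<mu> :: "('b \<times> real) measure" and M where \<mu>0:
    "\<mu> \<in> ball_measures" "M > 0" "emeasure \<mu> UNIV = ennreal M"
    "c_dim \<alpha> \<mu> \<le> ennreal ((10 * real DIM('b \<times> real)) ^ DIM('b \<times> real) * 48 powr \<alpha> * M)"
    "AE x in \<mu>. \<exists>z\<in>int_lattice. norm ((R powr (- \<alpha> / real DIM('b \<times> real))) *\<^sub>R z) \<le> 1 / 2
      \<and> norm (x - (R powr (- \<alpha> / real DIM('b \<times> real))) *\<^sub>R z) \<le> 1 / (48 * R)"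
    by (rule lattice_measure[OF \<alpha>(1) \<alpha>' R(1)])
  have cd: "c_dim \<alpha> \<mu> \<le> ennreal (K * M)" using \<mu>0(4) unfolding DIM K_def by (simp add: ac_simps)
  have ae: "AE x in \<mu>. \<exists>z\<in>int_lattice. norm (s *\<^sub>R z) \<le> 1 / 2 \<and> norm (x - s *\<^sub>R z) \<le> 1 / (48 * R)"
    using \<mu>0(5) unfolding s' .
  note \<mu> = \<mu>0(1-3) cd ae
  have fin: "finite_measure \<mu>" "sets \<mu> = sets borel" using \<mu>(1) by (auto simp: ball_measures_def)
  have meas: "measure \<mu> UNIV = M" using \<mu>(2,3) by (simp add: measure_def)
  define \<epsilon> where "\<epsilon> = 1 / (24 * R)"
  have \<epsilon>: "0 < \<epsilon>" "\<epsilon> \<le> 1 / 24" "2 * \<epsilon> \<le> 1 / h"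
    using R hR h by (auto simp: \<epsilon>_def field_simps)
  define E where "E = (\<Union>w\<in>P. ball (w /\<^sub>R h) \<epsilon>)"
  have vol: "emeasure lborel E = ennreal (real (card P) * (V * \<epsilon> ^ d))"
  proof -
    have "disjoint_family_on (\<lambda>w. ball (w /\<^sub>R h) \<epsilon>) P"
      unfolding disjoint_family_on_def
    proof (intro ballI impI)
      fix w w' assume w: "w \<in> P" "w' \<in> P" "w \<noteq> w'"
      have "1 / h \<le> norm (w - w') / h"
        using int_lattice_separated[of w w'] w h by (intro divide_right_mono) (auto simp: P_def cone_lattice_points_def)
      also have "\<dots> = dist (w /\<^sub>R h) (w' /\<^sub>R h)"
        using h by (simp add: dist_norm divide_inverse flip: scaleR_diff_right)
      finally have "2 * \<epsilon> \<le> dist (w /\<^sub>R h) (w' /\<^sub>R h)" using \<epsilon> by linarith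
      then show "ball (w /\<^sub>R h) \<epsilon> \<inter> ball (w' /\<^sub>R h) \<epsilon> = {}"
        by (intro disjoint_ballI) simp
    qed
    then have "emeasure lborel E = (\<Sum>w\<in>P. emeasure lborel (ball (w /\<^sub>R h) \<epsilon>))"
      unfolding E_def using finite_cone_lattice_points by (intro sum_emeasure[symmetric]) (auto simp: P_def)
    also have "\<dots> = (\<Sum>w\<in>P. ennreal (V * \<epsilon> ^ d))" using \<epsilon> by (simp add: emeasure_ball V_def d_def)
    also have "\<dots> = ennreal (real (card P) * (V * \<epsilon> ^ d))"
      using \<epsilon> by (simp add: ennreal_mult ennreal_of_nat_eq_real_of_nat V_def)
    finally show ?thesis .
  qed
  have point: "1 \<le> norm \<xi> \<and> norm \<xi> \<le> 2
      \<and> ennreal ((M / 2)\<^sup>2) \<le> ennreal ((cmod (fourier_measure \<mu> (R *\<^sub>R (\<xi>, norm \<xi>))))\<^sup>2)" if "\<xi> \<in> E" for \<xi>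
  proof -
    from that obtain w where w: "w \<in> P" "dist (w /\<^sub>R h) \<xi> < \<epsilon>" by (auto simp: E_def)
    have wP: "w \<in> int_lattice" "norm w \<in> \<int>" "5/4 * h < norm w" "norm w \<le> 15/8 * h"
      using w by (auto simp: P_def cone_lattice_points_def)
    have nw: "5/4 \<le> norm (w /\<^sub>R h)" "norm (w /\<^sub>R h) \<le> 15/8"
      using wP h by (auto simp: divide_inverse[symmetric] field_simps)
    have d: "norm (\<xi> - w /\<^sub>R h) < \<epsilon>" using w by (simp add: dist_norm norm_minus_commute)
    have "\<bar>norm \<xi> - norm (w /\<^sub>R h)\<bar> \<le> norm (\<xi> - w /\<^sub>R h)" by (rule norm_triangle_ineq3)
    with d nw \<epsilon> have n\<xi>: "1 \<le> norm \<xi>" "norm \<xi> \<le> 2" by linarith+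
    have "M / 2 \<le> cmod (fourier_measure \<mu> (R *\<^sub>R (\<xi>, norm \<xi>)))"
      unfolding meas[symmetric]
      using d n\<xi> by (intro fourier_large_near_cone_point[OF fin R(2) s \<mu>(5) wP(1,2)]) (auto simp: sR \<epsilon>_def)
    then show ?thesis using n\<xi> \<mu>(2) by (intro conjI ennreal_leI power_mono) auto
  qed
  have "ennreal ((M / 2)\<^sup>2) * emeasure lborel E
      \<le> (\<integral>\<^sup>+\<xi>. ennreal ((cmod (fourier_measure \<mu> (R *\<^sub>R \<xi>)))\<^sup>2) \<partial>cone_measure)"
    using point by (intro nn_integral_cone_measure_ge) (auto simp: E_def)
  also have "\<dots> \<le> ennreal C * emeasure \<mu> UNIV * c_dim \<alpha> \<mu> * ennreal (R powr (- \<beta>))"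
    using dec \<mu>(1) R unfolding decay_estimate_def by blast
  also have "\<dots> \<le> ennreal C * ennreal M * ennreal (K * M) * ennreal (R powr (- \<beta>))"
    unfolding \<mu>(3) using \<mu>(4) by (intro mult_mono) auto
  finally have "ennreal ((M / 2)\<^sup>2 * (real (card P) * (V * \<epsilon> ^ d))) \<le> ennreal (C * M * (K * M) * R powr (- \<beta>))"
    unfolding vol using C \<mu>(2) \<epsilon> by (simp add: ennreal_mult[symmetric] K_def V_def)
  then have "(M / 2)\<^sup>2 * (real (card P) * (V * \<epsilon> ^ d)) \<le> C * M * (K * M) * R powr (- \<beta>)"
    using C \<mu>(2) by (subst (asm) ennreal_le_iff) (auto simp: K_def)
  then have "M\<^sup>2 * (real (card P) * (V * \<epsilon> ^ d)) \<le> M\<^sup>2 * (4 * C * K * R powr (- \<beta>))"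
    by (simp add: power2_eq_square field_simps)
  then have "real (card P) * (V * \<epsilon> ^ d) \<le> 4 * C * K * R powr (- \<beta>)"
    using \<mu>(2) by (subst (asm) mult_le_cancel_left_pos) auto
  moreover have "\<epsilon> ^ d = R powr (- real d) / 24 ^ d"
    using R by (simp add: \<epsilon>_def power_divide power_mult_distrib powr_minus powr_realpow field_simps)
  ultimately have "real (card P) * (V * (R powr (- real d) / 24 ^ d)) \<le> 4 * C * K * R powr (- \<beta>)" by simp
  moreover have V: "V > 0" by (simp add: V_def)
  ultimately have "real (card P) \<le> (4 * C * K * 24 ^ d / V) * (R powr (- \<beta>) * R powr real d)"
    using R by (simp add: field_simps powr_minus)
  also have "R powr (- \<beta>) * R powr real d = R powr (real d - \<beta>)" using R by (simp flip: powr_add)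
  also have "\<dots> = h powr ((real d - \<beta>) / (1 - \<kappa>))" by (simp add: R_def powr_powr)
  finally show "real (card (cone_lattice_points (5/4 * h) (15/8 * h) :: 'b set))
    \<le> (4 * C * ((10 * (real d + 1)) ^ (d + 1) * 48 powr \<alpha>) * 24 ^ d / unit_ball_vol (real d)) * h powr ((real d - \<beta>) / (1 - \<kappa>))"
    unfolding P_def K_def V_def .
qed

text \<open>
  An admissible \<open>\<beta>\<close> above the bound would make \<open>(d - \<beta>) / (1 - \<alpha> / (d + 1))\<close> smaller than
  \<open>d - 1\<close>, so that the shells would contain fewer integer points than they do.
\<close>
theorem decay_exponent_cone_le:
  fixes \<alpha> :: real
  assumes dim: "DIM('b::euclidean_space) \<ge> 4" and \<alpha>: "0 < \<alpha>" "\<alpha> < real DIM('b) + 1"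
  shows "decay_exponent \<alpha> (cone_measure :: ('b \<times> real) measure)
    \<le> ereal (\<alpha> - 1 + 2 * (real DIM('b) + 1 - \<alpha>) / (real DIM('b) + 1))"
  unfolding decay_exponent_def
proof (rule SUP_least, clarify, rule ccontr)
  fix \<beta> C :: real
  define d where "d = real DIM('b)"
  define \<kappa> where "\<kappa> = \<alpha> / (d + 1)"
  assume C: "C > 0" and dec: "decay_estimate (cone_measure :: ('b \<times> real) measure) \<alpha> \<beta> C"
    and "\<not> ereal \<beta> \<le> ereal (\<alpha> - 1 + 2 * (real DIM('b) + 1 - \<alpha>) / (real DIM('b) + 1))"
  then have \<beta>: "\<alpha> - 1 + 2 * (d + 1 - \<alpha>) / (d + 1) < \<beta>" by (simp add: d_def)
  have \<kappa>: "\<kappa> < 1" using \<alpha> by (simp add: \<kappa>_def d_def)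
  have "\<alpha> - 1 + 2 * (d + 1 - \<alpha>) / (d + 1) = d - (d - 1) * (1 - \<kappa>)"
    unfolding \<kappa>_def using DIM_positive[where 'a='b] by (simp add: d_def field_simps)
  with \<beta> have "d - \<beta> < (d - 1) * (1 - \<kappa>)" by simp
  then have "(d - \<beta>) / (1 - \<kappa>) < d - 1" using \<kappa> by (simp add: pos_divide_less_eq)
  then have \<gamma>: "(d - \<beta>) / (1 - \<kappa>) < real (DIM('b) - 1)" using dim by (simp add: d_def of_nat_diff)
  obtain C' where "\<forall>h\<ge>1. real (card (cone_lattice_points (5/4 * h) (15/8 * h) :: 'b set))
      \<le> C' * h powr ((d - \<beta>) / (1 - \<kappa>))"
    using shell_count_le_of_decay_estimate[OF \<alpha> C dec] unfolding \<kappa>_def d_def by blast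
  with cone_lattice_points_shell_growth[OF dim \<gamma>, of C'] show False by (meson not_le)
qed

theorem proposition5p5:
  fixes \<alpha> :: real
  assumes "CARD('d::finite) \<ge> 5"
    and "0 < \<alpha>" and "\<alpha> < real CARD('d) + 1"
  shows "decay_exponent \<alpha> (cone_measure :: ((real ^ 'd) \<times> real) measure)
    \<le> ereal (\<alpha> - 1 + 2 * (real CARD('d) + 1 - \<alpha>) / (real CARD('d) + 1))"
  using decay_exponent_cone_le[where 'b = "real ^ 'd" and \<alpha> = \<alpha>] assms by simp

end
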